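(* A non-negative real number $h$ is the topological entropy of a computable dynamical system $(\{0,1\}^{\mathbb{N}},f)$ with $f:\{0,1\}^{\mathbb{N}}\to\{0,1\}^{\mathbb{N}}$ surjective if and only if $h$ is $\Sigma_2$-computable.
   Context: A real number $x$ is $\Sigma_2$-computable if there is an algorithm computing a double sequence $(q_{ij})$ of rationals with $x=\sup_i\inf_j q_{ij}$. The system $(\{0,1\}^{\mathbb{N}},f)$ is computable if $f$ is computable, i.e. there exist a non-decreasing computable function $\varphi:\mathbb{N}\to\mathbb{N}$ and an algorithm which, given $n$ and the first $\varphi(n)$ symbols of a sequence $x$, computes the first $n$ symbols of $f(x)$. Topological entropy of a continuous map $f$ of a compact metric space $X$: for a finite open cover $\mathcal{U}$ of $X$ let $N_n(f,\mathcal{U})$ be the minimal cardinality of a sub-cover of $\bigvee_{0\le k\le n-1}f^{-k}(\mathcal{U})$ (the collection of all intersections $\bigcap_{k=0}^{n-1}f^{-k}(U_k)$, $U_k\in\mathcal{U}$), $h(f,\mathcal{U})=\inf_{n\ge1}\frac{\log_2 N_n(f,\mathcal{U})}{n}$, and $h(f)=\sup_{\mathcal{U}}h(f,\mathcal{U})$. The space $\{0,1\}^{\mathbb{N}}$ carries the product topology. *)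

theory Defs
  imports "HOL-Analysis.Analysis"
begin

text \<open>
  Model of computation: Kleene's partial recursive functions, given by programs with a
  big-step semantics. \<open>eval p xs y\<close> says that \<open>p\<close> halts on the input tuple \<open>xs\<close> with output \<open>y\<close>.
\<close>

datatype recf =
    Zero
  | Succ
  | Proj nat
  | Comp recf "recf list"
  | Rec recf recf
  | Mu recf

inductive eval :: "recf \<Rightarrow> nat list \<Rightarrow> nat \<Rightarrow> bool" where
  eval_Zero: "eval Zero xs 0"
| eval_Succ: "eval Succ [x] (Suc x)"
| eval_Proj: "i < length xs \<Longrightarrow> eval (Proj i) xs (xs ! i)"
| eval_Comp: "list_all2 (\<lambda>g y. eval g xs y) gs ys \<Longrightarrow> eval f ys z \<Longrightarrow> eval (Comp f gs) xs z"
| eval_Rec_0: "eval f xs z \<Longrightarrow> eval (Rec f g) (0 # xs) z"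
| eval_Rec_Suc: "eval (Rec f g) (n # xs) y \<Longrightarrow> eval g (n # y # xs) z \<Longrightarrow>
    eval (Rec f g) (Suc n # xs) z"
| eval_Mu: "eval f (n # xs) 0 \<Longrightarrow> (\<And>m. m < n \<Longrightarrow> \<exists>v. eval f (m # xs) (Suc v)) \<Longrightarrow>
    eval (Mu f) xs n"

lemma eval_deterministic:
  assumes "eval p xs y" "eval p xs z"
  shows "y = z"
  using assms
proof (induction arbitrary: z rule: eval.induct)
  case eval_Zero
  then show ?case by (cases rule: eval.cases) auto
next
  case eval_Succ
  then show ?case by (cases rule: eval.cases) auto
next
  case eval_Proj
  from eval_Proj.prems show ?case by (cases rule: eval.cases) auto
next
  case (eval_Comp xs gs ys f w)
  from eval_Comp.prems obtain ys' where ys': "list_all2 (\<lambda>g y. eval g xs y) gs ys'" "eval f ys' z"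
    by (cases rule: eval.cases) auto
  have "length ys = length ys'"
    using list_all2_lengthD[OF eval_Comp.IH(1)] list_all2_lengthD[OF ys'(1)] by (rule trans[OF sym])
  moreover have "ys ! i = ys' ! i" if i: "i < length ys" for i
  proof -
    have "eval (gs ! i) xs (ys' ! i)"
      using ys'(1) by (rule list_all2_nthD2) (use i calculation in simp)
    with list_all2_nthD2[OF eval_Comp.IH(1) i] show ?thesis by blast
  qed
  ultimately have "ys = ys'"
    by (rule nth_equalityI)
  with ys'(2) have "eval f ys z" by simp
  then show ?case by (rule eval_Comp.IH)
next
  case (eval_Rec_0 f xs w g)
  from eval_Rec_0.prems have "eval f xs z"
    by (cases rule: eval.cases) auto
  then show ?case by (rule eval_Rec_0.IH)
next
  case (eval_Rec_Suc f g n xs y w)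
  from eval_Rec_Suc.prems obtain y' where "eval (Rec f g) (n # xs) y'" "eval g (n # y' # xs) z"
    by (cases rule: eval.cases) auto
  moreover from this(1) have "y = y'" by (rule eval_Rec_Suc.IH(1))
  ultimately show ?case by (intro eval_Rec_Suc.IH(2)) simp
next
  case (eval_Mu f n xs)
  from eval_Mu.prems have z: "eval f (z # xs) 0" "\<And>m. m < z \<Longrightarrow> \<exists>v. eval f (m # xs) (Suc v)"
    by (cases rule: eval.cases; simp)+
  show ?case
  proof (rule linorder_cases[of n z])
    assume "n < z"
    with z(2) obtain v where "eval f (n # xs) (Suc v)" by blast
    then have "0 = Suc v" by (rule eval_Mu.IH(1))
    then show ?thesis by simp
  next
    assume "z < n"
    from eval_Mu.IH(2)[OF this] z(1) have "\<exists>v. Suc v = 0" by blast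
    then show ?thesis by simp
  qed
qed

definition computable :: "nat \<Rightarrow> (nat list \<Rightarrow> nat) \<Rightarrow> bool" where
  "computable k f \<longleftrightarrow> (\<exists>p. \<forall>xs. length xs = k \<longrightarrow> eval p xs (f xs))"

text \<open>
  A double sequence of rationals is computable if it can be written as \<open>(a - b) / (c + 1)\<close>
  with computable sequences \<open>a\<close>, \<open>b\<close>, \<open>c\<close> of natural numbers.
\<close>

definition computable_rat_seq2 :: "(nat \<Rightarrow> nat \<Rightarrow> rat) \<Rightarrow> bool" where
  "computable_rat_seq2 q \<longleftrightarrow>
    (\<exists>a b c :: nat \<Rightarrow> nat \<Rightarrow> nat.
      computable 2 (\<lambda>xs. a (xs ! 0) (xs ! 1)) \<and>
      computable 2 (\<lambda>xs. b (xs ! 0) (xs ! 1)) \<and>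
      computable 2 (\<lambda>xs. c (xs ! 0) (xs ! 1)) \<and>
      (\<forall>i j. q i j = (of_nat (a i j) - of_nat (b i j)) / of_nat (Suc (c i j))))"

text \<open>
  Suprema and infima are taken in the extended reals: an individual infimum may be \<open>-\<infinity>\<close>.
\<close>

definition Sigma2_computable :: "real \<Rightarrow> bool" where
  "Sigma2_computable x \<longleftrightarrow>
    (\<exists>q. computable_rat_seq2 q \<and> ereal x = (SUP i. INF j. ereal (of_rat (q i j))))"

text \<open>
  The Cantor space is the type \<open>nat \<Rightarrow> bool\<close>, with \<open>False\<close>, \<open>True\<close> standing for the symbols
  \<open>0\<close>, \<open>1\<close> and with the product topology of the library. The first \<open>n\<close> symbols of a sequence
  are passed to a program as the number having these binary digits (least significant first);
  this encoding is injective on words of a given length, and both word lengths involved below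
  are computable from the argument \<open>n\<close>.
\<close>

definition prefix_code :: "nat \<Rightarrow> (nat \<Rightarrow> bool) \<Rightarrow> nat" where
  "prefix_code n x = horner_sum of_bool 2 (map x [0..<n])"

definition computable_map :: "((nat \<Rightarrow> bool) \<Rightarrow> nat \<Rightarrow> bool) \<Rightarrow> bool" where
  "computable_map f \<longleftrightarrow>
    (\<exists>\<phi> :: nat \<Rightarrow> nat. mono \<phi> \<and> computable 1 (\<lambda>xs. \<phi> (xs ! 0)) \<and>
      (\<exists>p. \<forall>n x. eval p [n, prefix_code (\<phi> n) x] (prefix_code n (f x))))"

lemma prefix_code_eq_iff: "prefix_code n x = prefix_code n y \<longleftrightarrow> (\<forall>i<n. x i = y i)"
proof
  assume "prefix_code n x = prefix_code n y"
  then have "bit (prefix_code n x) i = bit (prefix_code n y) i" for i by (rule arg_cong)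
  moreover have "bit (prefix_code n z) i \<longleftrightarrow> i < n \<and> z i" for z i
    by (auto simp: prefix_code_def bit_horner_sum_bit_iff)
  ultimately show "\<forall>i<n. x i = y i" by blast
next
  assume "\<forall>i<n. x i = y i"
  then have "map x [0..<n] = map y [0..<n]" by simp
  then show "prefix_code n x = prefix_code n y" by (simp only: prefix_code_def)
qed

lemma computable_map_imp_continuous:
  assumes "computable_map f"
  shows "continuous_on UNIV f"
proof (rule continuous_on_coordinatewise_then_product)
  fix i
  from assms obtain \<phi> p
    where p: "\<And>n x. eval p [n, prefix_code (\<phi> n) x] (prefix_code n (f x))"
    unfolding computable_map_def by blast
  define m where "m = \<phi> (Suc i)"
  have *: "f x i = f y i" if "\<forall>j<m. x j = y j" for x y
  proof -
    have "prefix_code (\<phi> (Suc i)) x = prefix_code (\<phi> (Suc i)) y"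
      using that by (simp add: prefix_code_eq_iff m_def)
    then have "prefix_code (Suc i) (f x) = prefix_code (Suc i) (f y)"
      using p eval_deterministic by metis
    then show ?thesis by (simp add: prefix_code_eq_iff)
  qed
  have "open ((\<lambda>x. f x i) -` B)" for B
  proof (subst open_subopen, rule ballI)
    fix x assume x: "x \<in> (\<lambda>x. f x i) -` B"
    have "open {y :: nat \<Rightarrow> bool. \<forall>j\<in>{..<m}. y j \<in> {x j}}"
      by (rule product_topology_basis') (auto simp: open_discrete)
    with x * show "\<exists>T. open T \<and> x \<in> T \<and> T \<subseteq> (\<lambda>x. f x i) -` B"
      by (intro exI[of _ "{y. \<forall>j\<in>{..<m}. y j \<in> {x j}}"]) auto
  qed
  then show "continuous_on UNIV (\<lambda>x. f x i)"
    by (simp add: continuous_on_open_vimage)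
qed

definition open_cover :: "'a::topological_space set set \<Rightarrow> bool" where
  "open_cover U \<longleftrightarrow> (\<forall>A\<in>U. open A) \<and> \<Union>U = UNIV"

definition cover_join :: "('a \<Rightarrow> 'a) \<Rightarrow> 'a set set \<Rightarrow> nat \<Rightarrow> 'a set set" where
  "cover_join f U n = {(\<Inter>k<n. (f ^^ k) -` V k) | V. \<forall>k<n. V k \<in> U}"

definition min_subcover_card :: "('a \<Rightarrow> 'a) \<Rightarrow> 'a set set \<Rightarrow> nat \<Rightarrow> nat" where
  "min_subcover_card f U n =
    (LEAST m. \<exists>S \<subseteq> cover_join f U n. finite S \<and> \<Union>S = UNIV \<and> card S = m)"

definition cover_entropy :: "('a \<Rightarrow> 'a) \<Rightarrow> 'a set set \<Rightarrow> ereal" where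
  "cover_entropy f U = (INF n\<in>{1..}. ereal (log 2 (real (min_subcover_card f U n)) / real n))"

definition topological_entropy :: "('a::topological_space \<Rightarrow> 'a) \<Rightarrow> ereal" where
  "topological_entropy f = (SUP U\<in>{U. finite U \<and> open_cover U}. cover_entropy f U)"

end

theory Submission
  imports Defs "HOL-Library.Nat_Bijection"
begin

text \<open>
  Entropies are \<open>\<Sigma>\<^sub>2\<close>-computable. By compactness every open cover is refined by the partition into
  cylinders of some length \<open>m\<close>, so the entropy is the supremum over \<open>m\<close> of the entropies of these
  partitions (\<open>topological_entropy_cantor\<close>). For a partition, the minimal subcover of the \<open>n\<close>-fold join
  has as many elements as there are itineraries of length \<open>n\<close>. This number can be computed, because an
  itinerary depends on a prefix whose length the modulus of \<open>f\<close> provides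
  (\<open>recursive_card_range_itinerary\<close>). The entropy of the partition is an infimum of logarithms of
  computable numbers, and rounding up the logarithms of their powers turns it into an infimum of
  rationals (\<open>INF_ceil_log_powers\<close>).

  Conversely, let \<open>h = sup\<^sub>i inf\<^sub>j q\<^sub>i\<^sub>j\<close>. Then \<open>h\<close> is the supremum of \<open>0\<close> and of the positive rationals
  \<open>a / b\<close> that satisfy, for some \<open>i\<close>, the tests \<open>a / b \<le> q\<^sub>i\<^sub>j\<close> for all \<open>j\<close>. A union of disjoint systems
  that accumulate only at a fixed point has as entropy the supremum of their entropies. The sets
  \<open>1\<^sup>N 0 {0,1}\<^sup>\<nat>\<close> accumulate at \<open>1\<^sup>\<infinity>\<close> and cover all other points. So it suffices to attach to every
  triple \<open>N = (i, a, b)\<close> a system on \<open>1\<^sup>N 0 {0,1}\<^sup>\<nat>\<close> that has entropy \<open>a / b\<close> if all tests succeed, and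
  entropy \<open>0\<close> if one of them fails. A point of this set is \<open>1\<^sup>N 0 w y\<close> with \<open>w\<close> of length \<open>b\<close>. The word
  \<open>w\<close> is a clock: it is rotated in each step, and only when \<open>w = 1 0 \<dots> 0\<close> does the tape \<open>y\<close> move. While
  no test fails, the tape moves by a shift through \<open>a\<close> cells, which makes the entropy \<open>a / b\<close>
  (\<open>topological_entropy_tower_map_ge\<close>, \<open>topological_entropy_tower_map_le\<close>).

  The point of the construction is how a failure is made to kill the entropy without losing
  surjectivity. The tape is divided into blocks of length \<open>a\<close>, and test number \<open>s\<close> is made when block
  \<open>s\<close> is written. If the first failure occurs at block \<open>J\<close>, then block \<open>J\<close> receives the contents of block
  \<open>0\<close>, and the blocks after it stay as they are. The tape map is then not a shift but a rotation of the
  first \<open>J + 1\<close> blocks; it is a bijection of finite order and adds no entropy. A finite part of the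
  image needs only finitely many tests, so the map is computable in either case, although the case
  is undecidable.
\<close>

section \<open>Computable functions\<close>

text \<open>
  Variables are positions of an environment \<open>e\<close>, and programs receive its first \<open>k\<close> values. A bound
  variable becomes position \<open>0\<close> and pushes the others up by one. The closure rules for
  arithmetic, logic and bounded search then have higher-order patterns as conclusions, so that the
  computability of an explicit term follows by resolution. Quantifying over total environments makes
  \<open>f\<close> independent of the positions from \<open>k\<close> on, so that variables can be renamed freely.
\<close>

definition recursive :: "nat \<Rightarrow> ((nat \<Rightarrow> nat) \<Rightarrow> nat) \<Rightarrow> bool" where
  "recursive k f \<longleftrightarrow> (\<exists>p. \<forall>e. eval p (map e [0..<k]) (f e))"

definition decidable :: "nat \<Rightarrow> ((nat \<Rightarrow> nat) \<Rightarrow> bool) \<Rightarrow> bool" where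
  "decidable k P \<longleftrightarrow> recursive k (\<lambda>e. of_bool (P e))"

lemma map_env: "length xs = k \<Longrightarrow> map ((!) xs) [0..<k] = xs"
  using map_nth by blast

lemma recursive_iff_computable1:
  "recursive 1 (\<lambda>e. f (e 0)) \<longleftrightarrow> computable 1 (\<lambda>xs. f (xs ! 0))"
proof
  assume "recursive 1 (\<lambda>e. f (e 0))"
  then obtain p where p: "\<And>e. eval p (map e [0..<1]) (f (e 0))"
    unfolding recursive_def by blast
  have "eval p xs (f (xs ! 0))" if "length xs = 1" for xs
    using p[of "(!) xs"] map_env[OF that] by simp
  then show "computable 1 (\<lambda>xs. f (xs ! 0))" unfolding computable_def by blast
next
  assume "computable 1 (\<lambda>xs. f (xs ! 0))"
  then obtain p where p: "\<And>xs. length xs = 1 \<Longrightarrow> eval p xs (f (xs ! 0))"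
    unfolding computable_def by blast
  have "eval p (map e [0..<1]) (f (e 0))" for e
    using p[of "map e [0..<1]"] by simp
  then show "recursive 1 (\<lambda>e. f (e 0))" unfolding recursive_def by blast
qed

lemma recursive_iff_computable2:
  "recursive 2 (\<lambda>e. f (e 0) (e 1)) \<longleftrightarrow> computable 2 (\<lambda>xs. f (xs ! 0) (xs ! 1))"
proof
  assume "recursive 2 (\<lambda>e. f (e 0) (e 1))"
  then obtain p where p: "\<And>e. eval p (map e [0..<2]) (f (e 0) (e 1))"
    unfolding recursive_def by blast
  have "eval p xs (f (xs ! 0) (xs ! 1))" if "length xs = 2" for xs
    using p[of "(!) xs"] map_env[OF that] by simp
  then show "computable 2 (\<lambda>xs. f (xs ! 0) (xs ! 1))" unfolding computable_def by blast
next
  assume "computable 2 (\<lambda>xs. f (xs ! 0) (xs ! 1))"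
  then obtain p where p: "\<And>xs. length xs = 2 \<Longrightarrow> eval p xs (f (xs ! 0) (xs ! 1))"
    unfolding computable_def by blast
  have "eval p (map e [0..<2]) (f (e 0) (e 1))" for e
    using p[of "map e [0..<2]"] by simp
  then show "recursive 2 (\<lambda>e. f (e 0) (e 1))" unfolding recursive_def by blast
qed

lemma recursive_var: "i < k \<Longrightarrow> recursive k (\<lambda>e. e i)"
  unfolding recursive_def using eval_Proj[of i "map _ [0..<k]"] by (intro exI[of _ "Proj i"]) simp

lemma recursive_subst:
  assumes "recursive n f" and "\<And>i. i < n \<Longrightarrow> recursive k (g i)"
  shows "recursive k (\<lambda>e. f (\<lambda>i. g i e))"
proof -
  obtain p where p: "\<And>e. eval p (map e [0..<n]) (f e)"
    using assms(1) unfolding recursive_def by blast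
  have "\<forall>i. \<exists>q. i < n \<longrightarrow> (\<forall>e. eval q (map e [0..<k]) (g i e))"
    using assms(2) unfolding recursive_def by blast
  then obtain q where q: "\<And>i e. i < n \<Longrightarrow> eval (q i) (map e [0..<k]) (g i e)"
    by metis
  have "eval (Comp p (map q [0..<n])) (map e [0..<k]) (f (\<lambda>i. g i e))" for e
    by (rule eval_Comp[OF _ p]) (auto simp: list_all2_conv_all_nth q)
  then show ?thesis unfolding recursive_def by blast
qed

lemma recursive_Suc:
  assumes "recursive k A"
  shows "recursive k (\<lambda>e. Suc (A e))"
proof -
  have "recursive 1 (\<lambda>e. Suc (e 0))"
    unfolding recursive_def by (rule exI[of _ Succ]) (simp add: eval_Succ)
  from recursive_subst[OF this, of k "\<lambda>_. A"] assms show ?thesis by simp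
qed

lemma recursive_const: "recursive k (\<lambda>e. c)"
proof (induction c)
  case 0
  show ?case unfolding recursive_def by (rule exI[of _ Zero]) (simp add: eval_Zero)
next
  case (Suc c)
  then show ?case by (rule recursive_Suc)
qed

lemma recursive_compose1:
  assumes "recursive 1 (\<lambda>e. F (e 0))" "recursive k A"
  shows "recursive k (\<lambda>e. F (A e))"
  using recursive_subst[OF assms(1), of k "\<lambda>_. A"] assms(2) by simp

lemma recursive_compose2:
  assumes "recursive 2 (\<lambda>e. F (e 0) (e 1))" "recursive k A" "recursive k B"
  shows "recursive k (\<lambda>e. F (A e) (B e))"
  using recursive_subst[OF assms(1), of k "\<lambda>i. if i = 0 then A else B"] assms(2,3) by simp

lemma recursive_compose3:
  assumes "recursive 3 (\<lambda>e. F (e 0) (e 1) (e 2))" "recursive k A" "recursive k B" "recursive k C"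
  shows "recursive k (\<lambda>e. F (A e) (B e) (C e))"
  using recursive_subst[OF assms(1), of k "\<lambda>i. if i = 0 then A else if i = 1 then B else C"]
    assms(2-4) by simp

lemma recursive_rename:
  assumes "recursive n f" "\<And>i. i < n \<Longrightarrow> s i < k"
  shows "recursive k (\<lambda>e. f (\<lambda>i. e (s i)))"
  by (rule recursive_subst[OF assms(1)]) (intro recursive_var assms(2))

lemma map_upt_case: "map e [0..<Suc k] = e 0 # map (\<lambda>i. e (Suc i)) [0..<k]"
  by (simp only: map_upt_Suc)

lemma recursive_rec:
  assumes F: "recursive k F"
    and G: "recursive (Suc (Suc k)) (\<lambda>e. G (e 0) (e 1) (\<lambda>i. e (Suc (Suc i))))"
    and T: "recursive k T"
  shows "recursive k (\<lambda>e. rec_nat (F e) (\<lambda>n y. G n y e) (T e))"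
proof -
  obtain p where p: "\<And>e. eval p (map e [0..<k]) (F e)"
    using F unfolding recursive_def by blast
  obtain q where q: "\<And>e. eval q (map e [0..<Suc (Suc k)]) (G (e 0) (e 1) (\<lambda>i. e (Suc (Suc i))))"
    using G unfolding recursive_def by blast
  have "eval (Rec p q) (n # map e [0..<k]) (rec_nat (F e) (\<lambda>n y. G n y e) n)" for n e
  proof (induction n)
    case 0
    show ?case by (simp add: eval_Rec_0 p)
  next
    case (Suc n)
    let ?y = "rec_nat (F e) (\<lambda>n y. G n y e) n"
    have "eval q (n # ?y # map e [0..<k]) (G n ?y e)"
      using q[of "case_nat n (case_nat ?y e)"] by (simp add: map_upt_case del: upt_Suc)
    from eval_Rec_Suc[OF Suc this] show ?case by simp
  qed
  then have "recursive (Suc k) (\<lambda>e. rec_nat (F (\<lambda>i. e (Suc i))) (\<lambda>n y. G n y (\<lambda>i. e (Suc i))) (e 0))"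
    unfolding recursive_def map_upt_case by blast
  from recursive_subst[OF this, of k "case_nat T (\<lambda>i e. e i)"] T show ?thesis
    by (simp add: recursive_var split: nat.split)
qed

lemma recursive_add:
  assumes "recursive k A" "recursive k B"
  shows "recursive k (\<lambda>e. A e + B e)"
proof -
  have "rec_nat a (\<lambda>n y. Suc y) b = a + b" for a b by (induction b) auto
  moreover have "recursive k (\<lambda>e. rec_nat (A e) (\<lambda>n y. Suc y) (B e))"
    by (intro recursive_rec assms recursive_Suc recursive_var) simp
  ultimately show ?thesis by simp
qed

lemma recursive_pred:
  assumes "recursive k A"
  shows "recursive k (\<lambda>e. A e - 1)"
proof -
  have "rec_nat 0 (\<lambda>n y. n) a = a - 1" for a by (induction a) auto
  moreover have "recursive k (\<lambda>e. rec_nat 0 (\<lambda>n y. n) (A e))"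
    by (intro recursive_rec assms recursive_const recursive_var) simp
  ultimately show ?thesis by simp
qed

lemma recursive_diff:
  assumes "recursive k A" "recursive k B"
  shows "recursive k (\<lambda>e. A e - B e)"
proof -
  have "rec_nat a (\<lambda>n y. y - 1) b = a - b" for a b :: nat by (induction b) auto
  moreover have "recursive k (\<lambda>e. rec_nat (A e) (\<lambda>n y. y - 1) (B e))"
    by (intro recursive_rec assms recursive_pred recursive_var) simp
  ultimately show ?thesis by simp
qed

lemma recursive_shift2: "recursive k A \<Longrightarrow> recursive (Suc (Suc k)) (\<lambda>e. A (\<lambda>i. e (Suc (Suc i))))"
  by (rule recursive_rename) auto

lemma recursive_mult:
  assumes "recursive k A" "recursive k B"
  shows "recursive k (\<lambda>e. A e * B e)"
proof -
  have "rec_nat 0 (\<lambda>n y. y + a) b = a * b" for a b :: nat by (induction b) auto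
  moreover have "recursive k (\<lambda>e. rec_nat 0 (\<lambda>n y. y + A e) (B e))"
    by (intro recursive_rec assms recursive_const recursive_add recursive_shift2 recursive_var) simp
  ultimately show ?thesis by simp
qed

lemma recursive_power:
  assumes "recursive k A" "recursive k B"
  shows "recursive k (\<lambda>e. A e ^ B e)"
proof -
  have "rec_nat 1 (\<lambda>n y. y * a) b = a ^ b" for a b :: nat by (induction b) auto
  moreover have "recursive k (\<lambda>e. rec_nat 1 (\<lambda>n y. y * A e) (B e))"
    by (intro recursive_rec assms recursive_const recursive_mult recursive_shift2 recursive_var) simp
  ultimately show ?thesis by simp
qed

lemma recursive_sum:
  assumes "recursive (Suc k) (\<lambda>e. G (e 0) (\<lambda>i. e (Suc i)))" "recursive k T"
  shows "recursive k (\<lambda>e. \<Sum>i<T e. G i e)"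
proof -
  have "rec_nat 0 (\<lambda>n y. y + G n e) b = (\<Sum>i<b. G i e)" for b e
    by (induction b) auto
  moreover have "recursive (Suc (Suc k)) (\<lambda>e. G (e 0) (\<lambda>i. e (Suc (Suc i))))"
    using recursive_rename[OF assms(1), of "case_nat 0 (\<lambda>i. Suc (Suc i))" "Suc (Suc k)"]
    by (simp split: nat.split)
  then have "recursive k (\<lambda>e. rec_nat 0 (\<lambda>n y. y + G n e) (T e))"
    by (intro recursive_rec assms recursive_const recursive_add recursive_var) auto
  ultimately show ?thesis by simp
qed

lemma decidable_not:
  assumes "decidable k P"
  shows "decidable k (\<lambda>e. \<not> P e)"
proof -
  have "of_bool (\<not> p) = 1 - (of_bool p :: nat)" for p by simp
  with recursive_diff[OF recursive_const[of k 1]] assms show ?thesis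
    unfolding decidable_def by presburger
qed

lemma decidable_conj:
  assumes "decidable k P" "decidable k Q"
  shows "decidable k (\<lambda>e. P e \<and> Q e)"
  using assms unfolding decidable_def of_bool_conj by (rule recursive_mult)

lemma decidable_disj: "decidable k P \<Longrightarrow> decidable k Q \<Longrightarrow> decidable k (\<lambda>e. P e \<or> Q e)"
  using decidable_not[OF decidable_conj[OF decidable_not decidable_not]] by (simp only: de_Morgan_conj not_not)

lemma decidable_imp: "decidable k P \<Longrightarrow> decidable k Q \<Longrightarrow> decidable k (\<lambda>e. P e \<longrightarrow> Q e)"
  unfolding imp_conv_disj by (intro decidable_disj decidable_not)

lemma decidable_iff:
  "decidable k P \<Longrightarrow> decidable k Q \<Longrightarrow> decidable k (\<lambda>e. P e \<longleftrightarrow> Q e)"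
  unfolding iff_conv_conj_imp by (intro decidable_conj decidable_imp)

lemma decidable_le:
  assumes "recursive k A" "recursive k B"
  shows "decidable k (\<lambda>e. A e \<le> B e)"
proof -
  have "of_bool (a \<le> b) = 1 - (a - b)" for a b :: nat by auto
  then show ?thesis
    unfolding decidable_def by (simp add: recursive_diff recursive_const assms)
qed

lemma decidable_less:
  "recursive k A \<Longrightarrow> recursive k B \<Longrightarrow> decidable k (\<lambda>e. A e < B e)"
  unfolding Suc_le_eq[symmetric] by (intro decidable_le recursive_Suc)

lemma decidable_eq:
  "recursive k A \<Longrightarrow> recursive k B \<Longrightarrow> decidable k (\<lambda>e. A e = B e)"
  unfolding eq_iff by (intro decidable_conj decidable_le)

lemma decidable_ball:
  assumes "decidable (Suc k) (\<lambda>e. P (e 0) (\<lambda>i. e (Suc i)))" "recursive k T"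
  shows "decidable k (\<lambda>e. \<forall>i<T e. P i e)"
proof -
  have "decidable k (\<lambda>e. (\<Sum>i<T e. of_bool (\<not> P i e)) = (0::nat))"
    using decidable_not[OF assms(1)]
    by (intro decidable_eq recursive_sum recursive_const assms(2)) (simp add: decidable_def)
  moreover have "(\<Sum>i<T e. of_bool (\<not> P i e)) = (0::nat) \<longleftrightarrow> (\<forall>i<T e. P i e)" for e
    by (auto simp: sum_eq_0_iff)
  ultimately show ?thesis by simp
qed

lemma decidable_bex:
  assumes "decidable (Suc k) (\<lambda>e. P (e 0) (\<lambda>i. e (Suc i)))" "recursive k T"
  shows "decidable k (\<lambda>e. \<exists>i<T e. P i e)"
  using decidable_not[OF decidable_ball[OF decidable_not[OF assms(1)] assms(2)]] by simp

lemma recursive_of_bool: "decidable k P \<Longrightarrow> recursive k (\<lambda>e. of_bool (P e))"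
  unfolding decidable_def .

lemma decidable_compose2:
  assumes "decidable 2 (\<lambda>e. P (e 0) (e 1))" "recursive k A" "recursive k B"
  shows "decidable k (\<lambda>e. P (A e) (B e))"
  using recursive_compose2[of "\<lambda>m n. of_bool (P m n)"] assms unfolding decidable_def by blast

lemma recursive_if:
  assumes "decidable k P" "recursive k A" "recursive k B"
  shows "recursive k (\<lambda>e. if P e then A e else B e)"
proof -
  have "(if p then a else b) = of_bool p * a + of_bool (\<not> p) * b" for p and a b :: nat
    by simp
  then show ?thesis
    by (simp add: recursive_add recursive_mult recursive_of_bool decidable_not assms
        del: of_bool_not_iff)
qed

lemma recursive_Least:
  assumes P: "decidable (Suc k) (\<lambda>e. P (e 0) (\<lambda>i. e (Suc i)))" and ex: "\<And>e. \<exists>n. P n e"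
  shows "recursive k (\<lambda>e. LEAST n. P n e)"
proof -
  obtain p where p: "\<And>e. eval p (map e [0..<Suc k]) (of_bool (\<not> P (e 0) (\<lambda>i. e (Suc i))))"
    using decidable_not[OF P] unfolding decidable_def recursive_def by blast
  have p': "eval p (n # map e [0..<k]) (of_bool (\<not> P n e))" for n e
    using p[of "case_nat n e"] by (simp add: map_upt_case del: upt_Suc of_bool_not_iff)
  have "eval (Mu p) (map e [0..<k]) (LEAST n. P n e)" for e
  proof (rule eval_Mu)
    have "P (LEAST n. P n e) e" using ex by (rule LeastI_ex)
    then show "eval p ((LEAST n. P n e) # map e [0..<k]) 0" using p'[of "LEAST n. P n e" e] by simp
  next
    fix m assume "m < (LEAST n. P n e)"
    then have "\<not> P m e" by (rule not_less_Least)
    then show "\<exists>v. eval p (m # map e [0..<k]) (Suc v)" using p'[of m e] by auto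
  qed
  then show ?thesis unfolding recursive_def by blast
qed

lemma recursive_shift1: "recursive k A \<Longrightarrow> recursive (Suc k) (\<lambda>e. A (\<lambda>i. e (Suc i)))"
  by (rule recursive_rename) auto

lemma recursive_div:
  assumes "recursive k A" "recursive k B"
  shows "recursive k (\<lambda>e. A e div B e)"
proof -
  \<comment> \<open>The disjunct \<open>b = 0\<close> makes the search end at \<open>0\<close>, the value of a division by \<open>0\<close>.\<close>
  have *: "b = 0 \<or> a < b * Suc q \<longleftrightarrow> a div b \<le> q" for a b q :: nat
    by (cases "b = 0")
      (simp_all add: div_less_iff_less_mult mult.commute del: mult_Suc mult_Suc_right flip: less_Suc_eq_le)
  have "(LEAST q. b = 0 \<or> a < b * Suc q) = a div b" for a b :: nat
    unfolding * by (rule Least_equality) auto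
  moreover have "recursive k (\<lambda>e. LEAST q. B e = 0 \<or> A e < B e * Suc q)"
    by (intro recursive_Least decidable_disj decidable_eq decidable_less recursive_mult recursive_Suc
        recursive_const recursive_shift1 recursive_var assms) (unfold *, auto)
  ultimately show ?thesis by simp
qed

lemma recursive_mod:
  assumes "recursive k A" "recursive k B"
  shows "recursive k (\<lambda>e. A e mod B e)"
  using recursive_diff[OF assms(1) recursive_mult[OF assms(2) recursive_div[OF assms]]]
  by (simp add: minus_mult_div_eq_mod)

lemma decidable_bit:
  assumes "recursive k A" "recursive k B"
  shows "decidable k (\<lambda>e. bit (A e) (B e))"
proof -
  have "bit a b \<longleftrightarrow> (a div 2 ^ b) mod 2 = 1" for a b :: nat
    by (simp add: bit_iff_odd odd_iff_mod_2_eq_one)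
  then show ?thesis
    by (simp only:) (intro decidable_eq recursive_mod recursive_div recursive_power recursive_const assms)
qed

lemma recursive_prod_decode:
  assumes "recursive k A"
  shows "recursive k (\<lambda>e. fst (prod_decode (A e)))" and "recursive k (\<lambda>e. snd (prod_decode (A e)))"
proof -
  have enc: "triangle (u + v) + u = n \<longleftrightarrow> prod_decode n = (u, v)" for u v n
    using prod_decode_inverse[of n] prod_encode_inverse[of "(u, v)"] by (auto simp: prod_encode_def)
  have code: "\<exists>u v. prod_decode n = (u, v) \<and> u < Suc n \<and> v < Suc n" for n
  proof -
    obtain u v where uv: "prod_decode n = (u, v)" by fastforce
    then have "n = prod_encode (u, v)" by (metis prod_decode_inverse)
    with uv show ?thesis
      using le_prod_encode_1[of u v] le_prod_encode_2[of v u] by (simp add: less_Suc_eq_le)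
  qed
  have tri: "recursive j (\<lambda>e. triangle (B e))" if "recursive j B" for j B
    unfolding triangle_def by (intro recursive_div recursive_mult recursive_Suc recursive_const that)
  note intros = recursive_Least decidable_bex decidable_eq recursive_add tri
    recursive_Suc recursive_var recursive_shift1[OF assms] recursive_shift2[OF assms]
  have "(LEAST u. \<exists>v<Suc n. triangle (u + v) + u = n) = fst (prod_decode n)" for n
    unfolding enc using code[of n] by (intro Least_equality) auto
  moreover have "recursive k (\<lambda>e. LEAST u. \<exists>v<Suc (A e). triangle (u + v) + u = A e)"
    by (intro intros) (simp_all add: enc, use code in blast)
  ultimately show "recursive k (\<lambda>e. fst (prod_decode (A e)))" by simp
  have "(LEAST v. \<exists>u<Suc n. triangle (u + v) + u = n) = snd (prod_decode n)" for n
    unfolding enc using code[of n] by (intro Least_equality) auto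
  moreover have "recursive k (\<lambda>e. LEAST v. \<exists>u<Suc (A e). triangle (u + v) + u = A e)"
    by (intro intros) (simp_all add: enc, use code in blast)
  ultimately show "recursive k (\<lambda>e. snd (prod_decode (A e)))" by simp
qed

lemmas recursive_intros = recursive_prod_decode decidable_bit recursive_mod recursive_div
  recursive_if recursive_of_bool decidable_bex decidable_ball decidable_eq decidable_less decidable_le
  decidable_iff decidable_imp decidable_disj decidable_conj decidable_not recursive_sum recursive_power
  recursive_mult recursive_diff recursive_add recursive_Suc recursive_const

section \<open>Entropy on the Cantor space\<close>

lemma bit_prefix_code: "bit (prefix_code n x) i \<longleftrightarrow> i < n \<and> x i"
  by (auto simp: prefix_code_def bit_horner_sum_bit_iff)

lemma prefix_code_bit: "prefix_code n (bit c) = c mod 2 ^ n"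
  by (simp add: prefix_code_def horner_sum_bit_eq_take_bit take_bit_eq_mod)

lemma prefix_code_eq_sum: "prefix_code n x = (\<Sum>k<n. of_bool (x k) * 2 ^ k)"
  by (auto simp: prefix_code_def horner_sum_eq_sum lessThan_atLeast0 intro!: sum.cong)

lemma prefix_code_less: "prefix_code n x < 2 ^ n"
proof -
  have "take_bit n (prefix_code n x) = prefix_code n x"
    by (rule bit_eqI) (auto simp: bit_take_bit_iff bit_prefix_code)
  then show ?thesis by (metis take_bit_nat_less_exp)
qed

lemma recursive_prefix_code:
  assumes "decidable (Suc k) (\<lambda>e. X (\<lambda>i. e (Suc i)) (e 0))" "recursive k n"
  shows "recursive k (\<lambda>e. prefix_code (n e) (X e))"
  unfolding prefix_code_eq_sum using assms
  by (intro recursive_sum recursive_mult recursive_of_bool recursive_power recursive_const recursive_var) auto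

definition cylinder :: "nat \<Rightarrow> (nat \<Rightarrow> bool) \<Rightarrow> (nat \<Rightarrow> bool) set" where
  "cylinder m x = {y. \<forall>i<m. y i = x i}"

definition cylinders :: "nat \<Rightarrow> (nat \<Rightarrow> bool) set set" where
  "cylinders m = range (cylinder m)"

text \<open>
  The prefixes of length \<open>m\<close> of \<open>x, f x, \<dots>, f\<^sup>n\<^sup>-\<^sup>1 x\<close>, concatenated to one binary word. As a number the
  itinerary can be handed to programs.
\<close>

definition itinerary ::
  "((nat \<Rightarrow> bool) \<Rightarrow> nat \<Rightarrow> bool) \<Rightarrow> nat \<Rightarrow> nat \<Rightarrow> (nat \<Rightarrow> bool) \<Rightarrow> nat" where
  "itinerary f m n x = prefix_code (n * m) (\<lambda>j. (f ^^ (j div m)) x (j mod m))"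

lemma itinerary_eq_iff:
  "itinerary f m n x = itinerary f m n y \<longleftrightarrow> (\<forall>k<n. \<forall>i<m. (f ^^ k) x i = (f ^^ k) y i)"
proof
  assume *: "itinerary f m n x = itinerary f m n y"
  show "\<forall>k<n. \<forall>i<m. (f ^^ k) x i = (f ^^ k) y i"
  proof (intro allI impI)
    fix k i assume "k < n" "i < m"
    then have "Suc k * m \<le> n * m" by (intro mult_right_mono) auto
    with \<open>i < m\<close> have "k * m + i < n * m" by simp
    with * \<open>i < m\<close> show "(f ^^ k) x i = (f ^^ k) y i"
      unfolding itinerary_def prefix_code_eq_iff by fastforce
  qed
next
  assume *: "\<forall>k<n. \<forall>i<m. (f ^^ k) x i = (f ^^ k) y i"
  have "j div m < n \<and> j mod m < m" if "j < n * m" for j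
    using that by (cases "m = 0") (auto simp: less_mult_imp_div_less)
  with * show "itinerary f m n x = itinerary f m n y"
    unfolding itinerary_def prefix_code_eq_iff by blast
qed

lemma finite_range_itinerary: "finite (range (itinerary f m n))"
  by (rule finite_subset[of _ "{..<2 ^ (n * m)}"]) (auto simp: itinerary_def prefix_code_less)

lemma card_range_itinerary_pos: "card (range (itinerary f m n)) > 0"
  using finite_range_itinerary[of f m n] by (simp add: card_gt_0_iff)

lemma itinerary_vimage_eq:
  "itinerary f m n -` {itinerary f m n x} = (\<Inter>k<n. (f ^^ k) -` cylinder m ((f ^^ k) x))"
  by (auto simp: itinerary_eq_iff cylinder_def)

text \<open>
  The nonempty elements of the join are the classes of points with equal itineraries. They are
  disjoint, hence a subcover cannot omit any of them.
\<close>

lemma min_subcover_card_cylinders: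
  "min_subcover_card f (cylinders m) n = card (range (itinerary f m n))"
  unfolding min_subcover_card_def
proof (rule Least_equality)
  let ?I = "itinerary f m n"
  let ?S = "(\<lambda>v. ?I -` {v}) ` range ?I"
  have "?S \<subseteq> cover_join f (cylinders m) n"
    unfolding cover_join_def cylinders_def itinerary_vimage_eq image_image
    by (intro image_subsetI CollectI) (rule exI[of _ "\<lambda>k. cylinder m ((f ^^ k) _)"], auto)
  moreover have "inj_on (\<lambda>v. ?I -` {v}) (range ?I)"
    by (rule inj_onI) blast
  then have "card ?S = card (range ?I)" by (rule card_image)
  ultimately show "\<exists>S\<subseteq>cover_join f (cylinders m) n. finite S \<and> \<Union> S = UNIV \<and> card S = card (range ?I)"
    using finite_range_itinerary by (intro exI[of _ ?S]) auto
next
  let ?I = "itinerary f m n"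
  fix c assume "\<exists>S\<subseteq>cover_join f (cylinders m) n. finite S \<and> \<Union> S = UNIV \<and> card S = c"
  then obtain S where S: "S \<subseteq> cover_join f (cylinders m) n" "finite S" "\<Union> S = UNIV" "card S = c"
    by blast
  have const: "?I y = ?I z" if "s \<in> S" "y \<in> s" "z \<in> s" for s y z
  proof -
    obtain V where V: "s = (\<Inter>k<n. (f ^^ k) -` V k)" "\<forall>k<n. V k \<in> cylinders m"
      using S(1) \<open>s \<in> S\<close> unfolding cover_join_def by blast
    have "\<forall>i<m. (f ^^ k) y i = (f ^^ k) z i" if "k < n" for k
    proof -
      obtain w where "V k = cylinder m w" using V(2) \<open>k < n\<close> unfolding cylinders_def by blast
      moreover have "(f ^^ k) y \<in> V k" "(f ^^ k) z \<in> V k"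
        using V(1) \<open>y \<in> s\<close> \<open>z \<in> s\<close> \<open>k < n\<close> by auto
      ultimately show ?thesis by (simp add: cylinder_def)
    qed
    then show ?thesis by (simp add: itinerary_eq_iff)
  qed
  have "range ?I \<subseteq> (\<lambda>s. ?I (SOME y. y \<in> s)) ` S"
  proof (rule image_subsetI)
    fix x
    have "x \<in> \<Union>S" using S(3) by simp
    then obtain s where s: "s \<in> S" "x \<in> s" by (rule UnionE)
    from s(2) have "(SOME y. y \<in> s) \<in> s" by (rule someI[of "\<lambda>y. y \<in> s"])
    from const[OF s this] s(1) show "?I x \<in> (\<lambda>s. ?I (SOME y. y \<in> s)) ` S" by (rule image_eqI)
  qed
  then have "card (range ?I) \<le> card ((\<lambda>s. ?I (SOME y. y \<in> s)) ` S)"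
    using S(2) by (intro card_mono) auto
  also have "\<dots> \<le> c" using card_image_le[OF S(2)] S(4) by blast
  finally show "card (range ?I) \<le> c" .
qed

text \<open>
  Each cell of the join of the cylinders is enlarged to an element of the join of \<open>U\<close>, chosen along
  the orbit of a representative of the cell.
\<close>

lemma min_subcover_card_refine:
  assumes "\<And>x. \<exists>A\<in>U. cylinder m x \<subseteq> A"
  shows "min_subcover_card f U n \<le> card (range (itinerary f m n))"
proof -
  let ?I = "itinerary f m n"
  obtain g where g: "\<And>x. g x \<in> U" "\<And>x. cylinder m x \<subseteq> g x" using assms by metis
  define cell where "cell v = (\<Inter>k<n. (f ^^ k) -` g ((f ^^ k) (inv ?I v)))" for v
  let ?S = "cell ` range ?I"
  have "y \<in> cell (?I y)" for y
  proof -
    have "?I (inv ?I (?I y)) = ?I y" by (simp add: f_inv_into_f)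
    then have "y \<in> (\<Inter>k<n. (f ^^ k) -` cylinder m ((f ^^ k) (inv ?I (?I y))))"
      unfolding itinerary_vimage_eq[symmetric] by simp
    with g(2) show ?thesis unfolding cell_def by blast
  qed
  then have "\<Union> ?S = UNIV" by blast
  moreover have "?S \<subseteq> cover_join f U n"
    unfolding cover_join_def cell_def
    by (intro image_subsetI CollectI) (rule exI[of _ "\<lambda>k. g ((f ^^ k) _)"], simp add: g(1))
  moreover have "finite ?S" by (intro finite_imageI finite_range_itinerary)
  ultimately have "min_subcover_card f U n \<le> card ?S"
    unfolding min_subcover_card_def by (intro Least_le exI[of _ ?S] conjI refl)
  also have "\<dots> \<le> card (range ?I)"
    by (rule card_image_le[OF finite_range_itinerary])
  finally show ?thesis .
qed

lemma compact_cantor: "compact (UNIV :: (nat \<Rightarrow> bool) set)"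
proof -
  have "compactin (product_topology (\<lambda>i::nat. euclidean :: bool topology) UNIV) (PiE UNIV (\<lambda>i. UNIV))"
    unfolding compactin_PiE by (simp add: finite_imp_compact)
  then show ?thesis by (simp add: euclidean_product_topology PiE_UNIV_domain)
qed

lemma open_cylinder: "open (cylinder m x)"
proof -
  have "open {y :: nat \<Rightarrow> bool. \<forall>j\<in>{..<m}. y j \<in> {x j}}"
    by (rule product_topology_basis') (auto simp: open_discrete)
  then show ?thesis by (simp add: cylinder_def lessThan_def)
qed

lemma open_contains_cylinder:
  assumes "open A" "x \<in> A"
  shows "\<exists>m. cylinder m x \<subseteq> A"
proof -
  obtain X where X: "x \<in> PiE UNIV X" "finite {i. X i \<noteq> UNIV}" "PiE UNIV X \<subseteq> A"
    using product_topology_open_contains_basis[of "\<lambda>_. euclidean" UNIV A x] assms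
    by (auto simp: open_fun_def)
  then obtain m where m: "\<And>i. X i \<noteq> UNIV \<Longrightarrow> i < m"
    using finite_nat_set_iff_bounded by auto
  have "y i \<in> X i" if "y \<in> cylinder m x" for y i
  proof (cases "X i = UNIV")
    case False
    from m[OF this] that have "y i = x i" by (simp add: cylinder_def)
    with X(1) show ?thesis by auto
  qed simp
  with X(3) have "cylinder m x \<subseteq> A" by (auto simp: PiE_UNIV_domain)
  then show ?thesis ..
qed

text \<open>
  The Lebesgue number of a cover, read as a prefix length.
\<close>

lemma open_cover_refined_by_cylinders:
  assumes "open_cover U"
  shows "\<exists>m. \<forall>x. \<exists>A\<in>U. cylinder m x \<subseteq> A"
proof -
  have "\<forall>x. \<exists>m. \<exists>A\<in>U. cylinder m x \<subseteq> A"
    using assms open_contains_cylinder unfolding open_cover_def by (metis UNIV_I UnionE)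
  then obtain l where l: "\<And>x. \<exists>A\<in>U. cylinder (l x) x \<subseteq> A" by metis
  have "UNIV \<subseteq> (\<Union>x\<in>UNIV. cylinder (l x) x)" by (auto simp: cylinder_def)
  then obtain F where F: "finite F" "UNIV \<subseteq> (\<Union>x\<in>F. cylinder (l x) x)"
    by (rule compactE_image[OF compact_cantor open_cylinder])
  have "\<exists>A\<in>U. cylinder (Max (l ` F)) y \<subseteq> A" for y
  proof -
    obtain x where x: "x \<in> F" "y \<in> cylinder (l x) x" using F(2) by auto
    then have "l x \<le> Max (l ` F)" using F(1) by simp
    with x(2) have "cylinder (Max (l ` F)) y \<subseteq> cylinder (l x) x" by (auto simp: cylinder_def)
    with l[of x] show ?thesis by blast
  qed
  then show ?thesis by blast
qed

lemma cylinders_open_cover: "finite (cylinders m)" "open_cover (cylinders m)"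
proof -
  have "cylinder m x \<in> (\<lambda>c::nat. cylinder m (bit c)) ` {..<2 ^ m}" for x
    by (rule image_eqI[where x = "prefix_code m x"])
      (auto simp: cylinder_def bit_prefix_code prefix_code_less)
  then have "cylinders m \<subseteq> (\<lambda>c::nat. cylinder m (bit c)) ` {..<2 ^ m}"
    unfolding cylinders_def by blast
  then show "finite (cylinders m)" by (rule finite_subset) simp
  show "open_cover (cylinders m)"
    unfolding open_cover_def cylinders_def using open_cylinder by (auto simp: cylinder_def)
qed

lemma cover_entropy_cylinders:
  "cover_entropy f (cylinders m) =
    (INF n\<in>{1..}. ereal (log 2 (real (card (range (itinerary f m n)))) / real n))"
  by (simp add: cover_entropy_def min_subcover_card_cylinders)

lemma topological_entropy_cantor:
  "topological_entropy f = (SUP m. cover_entropy f (cylinders m))"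
proof (rule antisym)
  show "(SUP m. cover_entropy f (cylinders m)) \<le> topological_entropy f"
    unfolding topological_entropy_def using cylinders_open_cover by (intro SUP_mono) auto
  show "topological_entropy f \<le> (SUP m. cover_entropy f (cylinders m))"
    unfolding topological_entropy_def
  proof (rule SUP_least)
    fix U :: "(nat \<Rightarrow> bool) set set" assume "U \<in> {U. finite U \<and> open_cover U}"
    then obtain m where m: "\<And>x. \<exists>A\<in>U. cylinder m x \<subseteq> A"
      using open_cover_refined_by_cylinders by blast
    have "log 2 (real (min_subcover_card f U n)) \<le> log 2 (real (card (range (itinerary f m n))))" for n
    \<comment> \<open>The logarithm is monotone only on positive numbers; \<open>log 2 0 = 0\<close> covers the other case.\<close>
    proof (cases "min_subcover_card f U n = 0")
      case True
      then show ?thesis using card_range_itinerary_pos[of f m n] by (simp add: log_def)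
    next
      case False
      then show ?thesis using min_subcover_card_refine[OF m, of f n] by simp
    qed
    then have "cover_entropy f U \<le> cover_entropy f (cylinders m)"
      unfolding cover_entropy_cylinders
      unfolding cover_entropy_def by (intro INF_superset_mono) (auto intro!: divide_right_mono)
    then show "cover_entropy f U \<le> (SUP m. cover_entropy f (cylinders m))"
      by (rule SUP_upper2[OF UNIV_I])
  qed
qed

lemma topological_entropy_nonneg: "0 \<le> topological_entropy (f :: (nat \<Rightarrow> bool) \<Rightarrow> nat \<Rightarrow> bool)"
proof -
  have "0 \<le> cover_entropy f (cylinders 0)"
    unfolding cover_entropy_cylinders
  proof (rule INF_greatest)
    fix n
    have "1 \<le> real (card (range (itinerary f 0 n)))"
      using card_range_itinerary_pos[of f 0 n] by linarith
    then have "0 \<le> log 2 (real (card (range (itinerary f 0 n))))" by simp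
    then show "0 \<le> ereal (log 2 (real (card (range (itinerary f 0 n)))) / real n)" by simp
  qed
  then show ?thesis
    unfolding topological_entropy_cantor by (rule SUP_upper2[OF UNIV_I])
qed

lemma card_range_itinerary_le:
  assumes "\<And>x y. \<forall>i<L. x i = y i \<Longrightarrow> itinerary f m n x = itinerary f m n y"
  shows "card (range (itinerary f m n)) \<le> 2 ^ L"
proof -
  have "itinerary f m n x \<in> (\<lambda>c::nat. itinerary f m n (bit c)) ` {..<2 ^ L}" for x
    by (rule image_eqI[where x = "prefix_code L x"], rule assms)
      (auto simp: bit_prefix_code prefix_code_less)
  then have "range (itinerary f m n) \<subseteq> (\<lambda>c::nat. itinerary f m n (bit c)) ` {..<2 ^ L}"
    by blast
  then have "card (range (itinerary f m n)) \<le> card {..<(2::nat) ^ L}"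
    by (rule surj_card_le[rotated]) simp
  then show ?thesis by simp
qed

text \<open>
  If the first \<open>D + h n\<close> symbols determine the itinerary, there are at most \<open>2\<close> to the power
  \<open>D + h n + 1\<close> itineraries, and the constant disappears after division by \<open>n\<close>.
\<close>

lemma topological_entropy_le:
  fixes f :: "(nat \<Rightarrow> bool) \<Rightarrow> nat \<Rightarrow> bool"
  assumes "h \<ge> 0"
    and det: "\<And>m. \<exists>D. \<forall>n x y. (\<forall>i. real i < real D + h * real n \<longrightarrow> x i = y i) \<longrightarrow>
      itinerary f m n x = itinerary f m n y"
  shows "topological_entropy f \<le> ereal h"
  unfolding topological_entropy_cantor
proof (rule SUP_least)
  fix m
  obtain D where D: "\<And>n x y. (\<And>i. real i < real D + h * real n \<Longrightarrow> x i = y i) \<Longrightarrow>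
      itinerary f m n x = itinerary f m n y"
    using det[of m] by blast
  have bound: "log 2 (real (card (range (itinerary f m n)))) \<le> real D + h * real n + 1" for n
  proof -
    define L where "L = nat \<lceil>real D + h * real n\<rceil>"
    have "0 \<le> real D + h * real n" using \<open>h \<ge> 0\<close> by simp
    then have L: "real D + h * real n \<le> real L" "real L \<le> real D + h * real n + 1"
      unfolding L_def by linarith+
    have "card (range (itinerary f m n)) \<le> 2 ^ L"
      by (rule card_range_itinerary_le, rule D) (use L(1) in force)
    then have "real (card (range (itinerary f m n))) \<le> 2 ^ L"
      by (metis of_nat_le_iff of_nat_numeral of_nat_power)
    then have "log 2 (real (card (range (itinerary f m n)))) \<le> log 2 (2 ^ L)"
      using card_range_itinerary_pos[of f m n] by (intro log_mono) auto
    with L(2) show ?thesis by simp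
  qed
  show "cover_entropy f (cylinders m) \<le> ereal h"
  proof (rule ereal_le_epsilon2)
    fix e :: real assume "0 < e"
    obtain n where n: "(real D + 1) / e < real n" using reals_Archimedean2 by blast
    with \<open>0 < e\<close> have "0 < real n" by (meson divide_nonneg_pos le_less_trans of_nat_0_le_iff add_nonneg_nonneg zero_le_one)
    then have "cover_entropy f (cylinders m) \<le> ereal (log 2 (real (card (range (itinerary f m n)))) / real n)"
      unfolding cover_entropy_cylinders by (intro INF_lower) auto
    also have "log 2 (real (card (range (itinerary f m n)))) / real n \<le> (real D + h * real n + 1) / real n"
      by (rule divide_right_mono[OF bound]) simp
    also have "\<dots> = h + (real D + 1) / real n" using \<open>0 < real n\<close> by (simp add: field_simps)
    also have "(real D + 1) / real n \<le> e"
      using n \<open>0 < e\<close> \<open>0 < real n\<close> by (simp add: field_simps)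
    finally show "cover_entropy f (cylinders m) \<le> ereal h + ereal e" by simp
  qed
qed

lemma topological_entropy_ge:
  assumes "\<And>n. n \<ge> 1 \<Longrightarrow> c * real n \<le> log 2 (real (card (range (itinerary f m n))))"
  shows "ereal c \<le> topological_entropy f"
proof -
  have "ereal c \<le> cover_entropy f (cylinders m)"
    unfolding cover_entropy_cylinders
  proof (rule INF_greatest)
    fix n :: nat assume "n \<in> {1..}"
    with assms[of n] show "ereal c \<le> ereal (log 2 (real (card (range (itinerary f m n)))) / real n)"
      by (simp add: pos_le_divide_eq)
  qed
  then show ?thesis
    unfolding topological_entropy_cantor by (rule SUP_upper2[OF UNIV_I])
qed

section \<open>Entropy as a supremum of infima of computable rationals\<close>

text \<open>
  Every number \<open>c\<close> names the point \<open>bit c\<close>, whose symbols are its binary digits, and these points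
  exhaust all prefixes. Reducing \<open>c\<close> modulo a power of two gives the program of \<open>f\<close> only legal inputs;
  this makes the computed function total.
\<close>

lemma computable_mapE:
  assumes "computable_map f"
  obtains \<phi> where "recursive 1 (\<lambda>e. \<phi> (e 0))"
    and "recursive 2 (\<lambda>e. prefix_code (e 0) (f (bit (e 1))))"
    and "\<And>n x y. \<forall>i<\<phi> n. x i = y i \<Longrightarrow> \<forall>i<n. f x i = f y i"
proof -
  obtain \<phi> p where \<phi>: "recursive 1 (\<lambda>e. \<phi> (e 0))"
    and p: "\<And>n x. eval p [n, prefix_code (\<phi> n) x] (prefix_code n (f x))"
    using assms unfolding computable_map_def recursive_iff_computable1 by blast
  have "recursive 2 (\<lambda>e. e 1 mod 2 ^ \<phi> (e 0))"
    by (intro recursive_intros recursive_compose1[OF \<phi>] recursive_var) auto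
  then obtain q where q: "\<And>e. eval q (map e [0..<2]) (e 1 mod 2 ^ \<phi> (e 0))"
    unfolding recursive_def by blast
  have "eval (Comp p [Proj 0, q]) (map e [0..<2]) (prefix_code (e 0) (f (bit (e 1))))" for e
  proof (rule eval_Comp)
    show "eval p [e 0, prefix_code (\<phi> (e 0)) (bit (e 1))] (prefix_code (e 0) (f (bit (e 1))))"
      by (rule p)
    have "eval (Proj 0) (map e [0..<2]) (e 0)"
      using eval_Proj[of 0 "map e [0..<2]"] by simp
    with q[of e] show "list_all2 (\<lambda>g. eval g (map e [0..<2])) [Proj 0, q]
      [e 0, prefix_code (\<phi> (e 0)) (bit (e 1))]"
      by (simp add: prefix_code_bit)
  qed
  then have "recursive 2 (\<lambda>e. prefix_code (e 0) (f (bit (e 1))))"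
    unfolding recursive_def by blast
  moreover have "\<forall>i<n. f x i = f y i" if "\<forall>i<\<phi> n. x i = y i" for n x y
  proof -
    have "prefix_code (\<phi> n) x = prefix_code (\<phi> n) y" using that by (simp add: prefix_code_eq_iff)
    with p[of n x] p[of n y] have "prefix_code n (f x) = prefix_code n (f y)"
      by (simp add: eval_deterministic)
    then show ?thesis by (simp add: prefix_code_eq_iff)
  qed
  ultimately show ?thesis using \<phi> that by blast
qed

lemma funpow_local:
  fixes f :: "(nat \<Rightarrow> bool) \<Rightarrow> nat \<Rightarrow> bool" and \<phi> :: "nat \<Rightarrow> nat"
  assumes "\<And>n x y. \<forall>i<\<phi> n. x i = y i \<Longrightarrow> \<forall>i<n. f x i = f y i"
    and "\<forall>i<(\<phi> ^^ k) n. x i = y i"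
  shows "\<forall>i<n. (f ^^ k) x i = (f ^^ k) y i"
  using assms(2)
proof (induction k arbitrary: n)
  case (Suc k)
  then have "\<forall>i<\<phi> n. (f ^^ k) x i = (f ^^ k) y i" by (intro Suc.IH) (simp add: funpow_swap1)
  then show ?case using assms(1) by simp
qed simp

text \<open>
  To know \<open>m\<close> symbols of \<open>f\<^sup>k x\<close>, compute backwards how many symbols of each iterate are needed:
  \<open>\<phi>\<^sup>k\<^sup>-\<^sup>t m\<close> symbols of \<open>f\<^sup>t x\<close>. The recursion \<open>S\<close> carries a number having these symbols as digits.
\<close>

lemma recursive_prefix_code_funpow:
  assumes \<phi>: "recursive 1 (\<lambda>e. \<phi> (e 0))"
    and f: "recursive 2 (\<lambda>e. prefix_code (e 0) (f (bit (e 1))))"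
    and loc: "\<And>n x y. \<forall>i<\<phi> n. x i = y i \<Longrightarrow> \<forall>i<n. f x i = f y i"
  shows "recursive 3 (\<lambda>e. prefix_code (e 1) ((f ^^ e 0) (bit (e 2))))"
proof -
  define S where "S k m c = rec_nat c (\<lambda>t s. prefix_code ((\<phi> ^^ (k - Suc t)) m) (f (bit s)))"
    for k m c :: nat
  have S: "\<forall>i<(\<phi> ^^ (k - t)) m. bit (S k m c t) i = (f ^^ t) (bit c) i" if "t \<le> k" for k m c t
    using that
  proof (induction t)
    case 0
    show ?case by (simp add: S_def)
  next
    case (Suc t)
    let ?l = "(\<phi> ^^ (k - Suc t)) m"
    have "k - t = Suc (k - Suc t)" using Suc.prems by simp
    then have "\<forall>i<\<phi> ?l. bit (S k m c t) i = (f ^^ t) (bit c) i"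
      using Suc by simp
    then have "\<forall>i<?l. f (bit (S k m c t)) i = (f ^^ Suc t) (bit c) i"
      using loc by simp
    then show ?case by (simp add: S_def bit_prefix_code)
  qed
  have "prefix_code m ((f ^^ k) (bit c)) = S k m c k mod 2 ^ m" for k m c
    unfolding prefix_code_bit[symmetric] prefix_code_eq_iff using S[of k k m c] by simp
  moreover have "(\<phi> ^^ j) m = rec_nat m (\<lambda>_ y. \<phi> y) j" for j m by (induction j) auto
  then have "recursive 3 (\<lambda>e. S (e 0) (e 1) (e 2) (e 0) mod 2 ^ e 1)"
    unfolding S_def
    by (simp only:)
      (intro recursive_intros recursive_rec recursive_compose2[OF f] recursive_compose1[OF \<phi>]
        recursive_var; simp)
  ultimately show ?thesis by simp
qed

text \<open>
  The prefixes of length \<open>M m n\<close> realize all itineraries, because \<open>M m n\<close> bounds the number of symbols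
  needed at each of the times below \<open>n\<close>. So the itineraries are counted by finite search.
\<close>

lemma recursive_card_range_itinerary:
  assumes "computable_map f"
  shows "recursive 2 (\<lambda>e. card (range (itinerary f (e 0) (e 1))))"
proof -
  obtain \<phi> where \<phi>: "recursive 1 (\<lambda>e. \<phi> (e 0))"
    and f: "recursive 2 (\<lambda>e. prefix_code (e 0) (f (bit (e 1))))"
    and loc: "\<And>n x y. \<forall>i<\<phi> n. x i = y i \<Longrightarrow> \<forall>i<n. f x i = f y i"
    using assms by (rule computable_mapE) blast
  define M where "M m n = (\<Sum>k<n. (\<phi> ^^ k) m)" for m n
  have M: "itinerary f m n x = itinerary f m n (bit (prefix_code (M m n) x))" for m n x
    unfolding itinerary_eq_iff
  proof (intro allI impI)
    fix k i assume "k < n" "i < m"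
    have "(\<phi> ^^ k) m \<le> M m n" unfolding M_def by (rule member_le_sum) (use \<open>k < n\<close> in auto)
    then have "\<forall>i<(\<phi> ^^ k) m. x i = bit (prefix_code (M m n) x) i" by (simp add: bit_prefix_code)
    from funpow_local[OF loc this] \<open>i < m\<close>
    show "(f ^^ k) x i = (f ^^ k) (bit (prefix_code (M m n) x)) i" by simp
  qed
  have M_rec: "recursive 2 (\<lambda>e. M (e 0) (e 1))"
  proof -
    have "(\<phi> ^^ j) m = rec_nat m (\<lambda>_ y. \<phi> y) j" for j m by (induction j) auto
    then show ?thesis
      unfolding M_def
      by (simp only:) (intro recursive_intros recursive_rec recursive_compose1[OF \<phi>] recursive_var; simp)
  qed
  have it_rec: "recursive 3 (\<lambda>e. itinerary f (e 0) (e 1) (bit (e 2)))"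
  proof -
    have "itinerary f m n (bit c) = (\<Sum>j<n * m.
        of_bool (bit (prefix_code (Suc (j mod m)) ((f ^^ (j div m)) (bit c))) (j mod m)) * 2 ^ j)"
      for m n and c :: nat
      by (simp add: itinerary_def prefix_code_eq_sum[of "n * m"] bit_prefix_code)
    then show ?thesis
      by (simp only:) (intro recursive_intros recursive_var
          recursive_compose3[OF recursive_prefix_code_funpow[OF \<phi> f loc]]; simp)
  qed
  have "card (range (itinerary f m n)) =
    (\<Sum>v<2 ^ (n * m). of_bool (\<exists>c<2 ^ M m n. itinerary f m n (bit (c :: nat)) = v))" for m n
  proof -
    have "range (itinerary f m n) = {v \<in> {..<2 ^ (n * m)}. \<exists>c<2 ^ M m n. itinerary f m n (bit (c :: nat)) = v}"
    proof -
      have "\<exists>c<2 ^ M m n. itinerary f m n (bit (c :: nat)) = itinerary f m n x" for x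
        using M[of m n x] prefix_code_less[of "M m n" x] by (intro exI[of _ "prefix_code (M m n) x"]) simp
      moreover have "itinerary f m n x < 2 ^ (n * m)" for x
        by (simp add: itinerary_def prefix_code_less)
      ultimately show ?thesis by auto
    qed
    then show ?thesis by (simp add: sum.If_cases of_bool_def Int_def)
  qed
  then show ?thesis
    by (simp only:) (intro recursive_intros recursive_var
        recursive_compose2[OF M_rec] recursive_compose3[OF it_rec]; simp)
qed

text \<open>
  Rounding \<open>log 2 (N n ^ k)\<close> up to an integer and dividing by \<open>k\<close> overestimates \<open>log 2 (N n)\<close> by at most
  \<open>1 / k\<close>. Letting the index run over the pairs \<open>(n, k)\<close> thus leaves the infimum unchanged.
\<close>

lemma INF_ceil_log_powers:
  fixes N :: "nat \<Rightarrow> nat"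
  assumes N: "\<And>n. N n > 0"
  shows "(INF j. ereal (real (LEAST a. N (Suc (fst (prod_decode j))) ^ Suc (snd (prod_decode j)) \<le> 2 ^ a)
      / real (Suc (fst (prod_decode j)) * Suc (snd (prod_decode j)))))
    = (INF n\<in>{1..}. ereal (log 2 (real (N n)) / real n))"
    (is "(INF j. ereal (?q j)) = ?R")
proof -
  define A where "A n k = (LEAST a. N n ^ k \<le> 2 ^ a)" for n k
  have A1: "real k * log 2 (real (N n)) \<le> real (A n k)" for n k
  proof -
    have "N n ^ k \<le> 2 ^ A n k"
      unfolding A_def by (rule LeastI[of _ "N n ^ k"]) (simp add: less_imp_le)
    then have "real (N n) ^ k \<le> 2 ^ A n k"
      by (metis of_nat_le_iff of_nat_numeral of_nat_power)
    then have "log 2 (real (N n) ^ k) \<le> log 2 (2 ^ A n k)" using N by (intro log_mono) auto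
    then show ?thesis using N by (simp add: log_nat_power)
  qed
  have A2: "real (A n k) \<le> real k * log 2 (real (N n)) + 1" for n k
  proof (cases "A n k")
    case (Suc a)
    then have "\<not> N n ^ k \<le> 2 ^ a" using not_less_Least[of a "\<lambda>a. N n ^ k \<le> 2 ^ a"] by (simp add: A_def)
    then have "2 ^ a \<le> real (N n) ^ k"
      by (metis linear of_nat_le_iff of_nat_numeral of_nat_power)
    then have "log 2 (2 ^ a) \<le> log 2 (real (N n) ^ k)" by (intro log_mono) auto
    then show ?thesis using N Suc by (simp add: log_nat_power)
  next
    case 0
    have "1 \<le> real (N n)" using N[of n] by simp
    with 0 show ?thesis by simp
  qed
  have q: "?q (prod_encode (n, k)) = real (A (Suc n) (Suc k)) / real (Suc n * Suc k)" for n k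
    by (simp only: prod_encode_inverse fst_conv snd_conv A_def)
  show ?thesis
  proof (rule antisym)
    show "?R \<le> (INF j. ereal (?q j))"
    proof (rule INF_greatest)
      fix j
      obtain n k where nk: "j = prod_encode (n, k)" by (metis prod_decode_inverse surj_pair)
      have "log 2 (real (N (Suc n))) / real (Suc n) \<le> ?q j"
      proof -
        have "log 2 (real (N (Suc n))) / real (Suc n) =
            (real (Suc k) * log 2 (real (N (Suc n)))) / real (Suc n * Suc k)"
          by (simp del: of_nat_Suc mult_Suc mult_Suc_right)
        also have "\<dots> \<le> ?q j"
          unfolding nk q by (intro divide_right_mono A1) simp
        finally show ?thesis .
      qed
      then show "?R \<le> ereal (?q j)" by (intro INF_lower2[of "Suc n"]) auto
    qed
    show "(INF j. ereal (?q j)) \<le> ?R"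
    proof (rule INF_greatest)
      fix n :: nat assume "n \<in> {1..}"
      then obtain n' where n': "n = Suc n'" by (cases n) auto
      show "(INF j. ereal (?q j)) \<le> ereal (log 2 (real (N n)) / real n)"
      proof (rule ereal_le_epsilon2)
        fix e :: real assume "0 < e"
        obtain k where k: "1 / e < real k" using reals_Archimedean2 by blast
        have "(INF j. ereal (?q j)) \<le> ereal (?q (prod_encode (n', k)))" by (rule INF_lower) simp
        also have "?q (prod_encode (n', k)) = real (A n (Suc k)) / real (n * Suc k)"
          unfolding q n' ..
        also have "\<dots> \<le> (real (Suc k) * log 2 (real (N n)) + 1) / real (n * Suc k)"
          by (intro divide_right_mono A2) simp
        also have "\<dots> = log 2 (real (N n)) / real n + 1 / (real n * real (Suc k))"
          using n' by (simp add: add_divide_distrib del: of_nat_Suc mult_Suc mult_Suc_right)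
        also have "1 / (real n * real (Suc k)) \<le> e"
        proof -
          have "1 \<le> e * real (Suc k)" using k \<open>0 < e\<close> by (simp add: field_simps)
          also have "\<dots> \<le> real n * (e * real (Suc k))"
            using mult_right_mono[of 1 "real n" "e * real (Suc k)"] n' \<open>0 < e\<close> by simp
          finally have "1 \<le> e * (real n * real (Suc k))" by (simp only: mult_ac)
          moreover have "0 < real n * real (Suc k)" using n' by simp
          ultimately show ?thesis by (simp only: pos_divide_le_eq)
        qed
        finally show "(INF j. ereal (?q j)) \<le> ereal (log 2 (real (N n)) / real n) + ereal e" by simp
      qed
    qed
  qed
qed

theorem Sigma2_computable_topological_entropy:
  assumes "computable_map f" "topological_entropy f = ereal h"
  shows "Sigma2_computable h"
proof -
  define N where "N i n = card (range (itinerary f i n))" for i n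
  define a where "a i j = (LEAST a. N i (Suc (fst (prod_decode j))) ^ Suc (snd (prod_decode j)) \<le> 2 ^ a)" for i j
  define c where "c j = Suc (fst (prod_decode j)) * Suc (snd (prod_decode j)) - 1" for j
  define q :: "nat \<Rightarrow> nat \<Rightarrow> rat" where "q i j = (of_nat (a i j) - of_nat 0) / of_nat (Suc (c j))" for i j
  have "recursive 2 (\<lambda>e. a (e 0) (e 1))"
    unfolding a_def N_def
  proof (intro recursive_Least recursive_intros recursive_var
      recursive_compose2[OF recursive_card_range_itinerary[OF assms(1)]])
    fix e :: "nat \<Rightarrow> nat"
    let ?x = "card (range (itinerary f (e 0) (Suc (fst (prod_decode (e 1)))))) ^ Suc (snd (prod_decode (e 1)))"
    show "\<exists>n. ?x \<le> 2 ^ n"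
      by (rule exI[of _ ?x]) (simp add: less_imp_le)
  qed simp_all
  moreover have "recursive 2 (\<lambda>e. c (e 1))"
    unfolding c_def by (intro recursive_intros recursive_var) simp_all
  ultimately have "computable_rat_seq2 q"
    unfolding computable_rat_seq2_def recursive_iff_computable2[symmetric] using q_def
    by (intro exI[of _ a] exI[of _ "\<lambda>_ _. 0"] exI[of _ "\<lambda>_. c"]) (simp add: recursive_const)
  moreover have "ereal h = (SUP i. INF j. ereal (of_rat (q i j)))"
  proof -
    have "of_rat (q i j) = real (a i j) / real (Suc (fst (prod_decode j)) * Suc (snd (prod_decode j)))" for i j
    proof -
      have "Suc (c j) = Suc (fst (prod_decode j)) * Suc (snd (prod_decode j))" by (simp add: c_def)
      then show ?thesis by (simp add: q_def of_rat_divide del: of_nat_Suc of_nat_mult)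
    qed
    then have "(INF j. ereal (of_rat (q i j))) = cover_entropy f (cylinders i)" for i
      unfolding cover_entropy_cylinders a_def
      using INF_ceil_log_powers[of "N i"] card_range_itinerary_pos by (simp add: N_def)
    then show ?thesis using assms(2) topological_entropy_cantor by simp
  qed
  ultimately show ?thesis unfolding Sigma2_computable_def by blast
qed

section \<open>The tower construction\<close>

text \<open>
  The source of cell \<open>j\<close> under the tape map, for tests \<open>T\<close> and block length \<open>a\<close>. If \<open>J\<close> is the first
  failing test, blocks \<open>0, \<dots>, J - 1\<close> read from the next block, block \<open>J\<close> reads from block \<open>0\<close>, and the
  cells behind read from themselves. Only the tests up to the number of the block of \<open>j\<close> are consulted;
  this is what keeps the map computable.
\<close>

definition shift_until_failure :: "(nat \<Rightarrow> bool) \<Rightarrow> nat \<Rightarrow> nat \<Rightarrow> nat" where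
  "shift_until_failure T a j =
    (if \<forall>s<Suc (j div a). T s then j + a else if \<forall>s<j div a. T s then j mod a else j)"

lemma shift_until_failure_le: "shift_until_failure T a j \<le> j + a"
  unfolding shift_until_failure_def by (simp add: trans_le_add1)

lemma shift_until_failure_never:
  assumes "\<And>s. T s"
  shows "(shift_until_failure T a ^^ r) j = j + a * r"
  using assms by (induction r) (simp_all add: shift_until_failure_def)

lemma shift_until_failure_eq:
  assumes "\<not> T J" "\<And>s. s < J \<Longrightarrow> T s"
  shows "shift_until_failure T a j =
    (if j div a < J then j + a else if j div a = J then j mod a else j)"
proof -
  have "(\<forall>s<q. T s) \<longleftrightarrow> q \<le> J" for q
    using assms by (meson leI le_less_trans less_le_trans)
  then show ?thesis unfolding shift_until_failure_def by (auto simp: Suc_le_eq)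
qed

text \<open>
  Two cells with the same source agree on whether they lie before, in or after the failing block:
  the sources lie in blocks \<open>1, \<dots>, J\<close>, in block \<open>0\<close>, and in blocks after \<open>J\<close>, respectively.
\<close>

lemma inj_shift_until_failure:
  assumes "a > 0"
  shows "inj (shift_until_failure T a)"
proof (cases "\<forall>s. T s")
  case True
  then show ?thesis by (intro injI) (simp add: shift_until_failure_def)
next
  case False
  define J where "J = (LEAST s. \<not> T s)"
  have eq: "shift_until_failure T a j =
      (if j div a < J then j + a else if j div a = J then j mod a else j)" for j
  proof (rule shift_until_failure_eq)
    show "\<not> T J" using False unfolding J_def by (metis (mono_tags) LeastI_ex)
    show "T s" if "s < J" for s using not_less_Least[OF that[unfolded J_def]] by simp
  qed
  have block: "shift_until_failure T a j div a =
      (if j div a < J then Suc (j div a) else if j div a = J then 0 else j div a)" for j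
    unfolding eq using assms by simp
  show ?thesis
  proof (rule injI)
    fix i j assume *: "shift_until_failure T a i = shift_until_failure T a j"
    then have "shift_until_failure T a i div a = shift_until_failure T a j div a" by simp
    then consider "i div a < J" "j div a < J" | "i div a = J" "j div a = J"
      | "i div a > J" "j div a > J"
      unfolding block by (auto split: if_splits)
    then show "i = j"
    proof cases
      case 2
      with * have "i mod a = j mod a" by (simp add: eq)
      with 2 show ?thesis by (metis div_mult_mod_eq)
    qed (use * in \<open>simp_all add: eq\<close>)
  qed
qed

text \<open>
  After a failure, all orbits of cells stay bounded, so the tape map produces no entropy.
\<close>

lemma shift_until_failure_bounded:
  assumes "\<not> T s"
  shows "\<exists>C. \<forall>r j. j < m \<longrightarrow> (shift_until_failure T a ^^ r) j \<le> C"
proof -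
  define J where "J = (LEAST s. \<not> T s)"
  have eq: "shift_until_failure T a j =
      (if j div a < J then j + a else if j div a = J then j mod a else j)" for j
  proof (rule shift_until_failure_eq)
    show "\<not> T J" using assms unfolding J_def by (rule LeastI)
    show "T s" if "s < J" for s using not_less_Least[OF that[unfolded J_def]] by simp
  qed
  have step: "shift_until_failure T a j \<le> max j (a * Suc J)" for j
  proof (cases "a = 0")
    case False
    then have "j + a \<le> a * Suc J" if "j div a < J"
      using that by (simp add: div_less_iff_less_mult mult.commute)
    moreover have "j mod a \<le> max j (a * Suc J)" by (intro max.coboundedI1 mod_less_eq_dividend)
    ultimately show ?thesis unfolding eq by (auto simp del: mult_Suc_right)
  qed (simp add: shift_until_failure_def)
  have "(shift_until_failure T a ^^ r) j \<le> max j (a * Suc J)" for r j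
  proof (induction r)
    case (Suc r)
    with step[of "(shift_until_failure T a ^^ r) j"] show ?case by (auto simp del: mult_Suc_right)
  qed simp
  then have "\<forall>r j. j < m \<longrightarrow> (shift_until_failure T a ^^ r) j \<le> max m (a * Suc J)"
    by (meson le_trans max.mono less_imp_le order_refl)
  then show ?thesis by blast
qed

definition first_zero :: "(nat \<Rightarrow> bool) \<Rightarrow> nat \<Rightarrow> bool" where
  "first_zero x N \<longleftrightarrow> \<not> x N \<and> (\<forall>i<N. x i)"

lemma first_zero_Least: "\<exists>i. \<not> x i \<Longrightarrow> first_zero x (LEAST i. \<not> x i)"
  unfolding first_zero_def using LeastI_ex[of "\<lambda>i. \<not> x i"] not_less_Least[of _ "\<lambda>i. \<not> x i"] by blast

lemma Least_first_zero: "first_zero x N \<Longrightarrow> (LEAST i. \<not> x i) = N"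
  unfolding first_zero_def by (intro Least_equality) (auto simp: not_less[symmetric])

lemma first_zero_cases:
  obtains "\<forall>i<m. x i" | N where "N < m" "first_zero x N"
proof (cases "\<forall>i<m. x i")
  case False
  then have "\<exists>i. \<not> x i" by blast
  moreover from False obtain i where "i < m" "\<not> x i" by blast
  then have "(LEAST i. \<not> x i) < m" using Least_le[of "\<lambda>i. \<not> x i" i] by simp
  ultimately show ?thesis using first_zero_Least that(2) by blast
qed (use that in blast)

text \<open>
  System \<open>N\<close> has \<open>b N\<close> clock cells, tape blocks of length \<open>a N\<close> and the tests \<open>T N\<close>. The bound on
  \<open>a N\<close> limits how far the map looks ahead, and so gives it the modulus \<open>2 n\<close>.
\<close>

locale tower_family =
  fixes a b :: "nat \<Rightarrow> nat" and T :: "nat \<Rightarrow> nat \<Rightarrow> bool"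
  assumes a_pos: "a N > 0" and a_le: "a N \<le> Suc N" and b_pos: "b N > 0"
begin

abbreviation \<tau> :: "nat \<Rightarrow> nat \<Rightarrow> nat" where
  "\<tau> N \<equiv> shift_until_failure (T N) (a N)"

definition marked :: "nat \<Rightarrow> (nat \<Rightarrow> bool) \<Rightarrow> bool" where
  "marked N x \<longleftrightarrow> (\<forall>l<b N. x (Suc N + l) \<longleftrightarrow> l = 0)"

text \<open>
  The position copied to position \<open>k\<close> of the image: the prefix \<open>1\<^sup>N 0\<close> is kept, the clock is rotated,
  and the tape is moved if \<open>q\<close> holds. For fixed \<open>N\<close> and \<open>q\<close> the position map is
  injective, which is where surjectivity comes from.
\<close>

definition source :: "nat \<Rightarrow> bool \<Rightarrow> nat \<Rightarrow> nat" where
  "source N q k =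
    (if k \<le> N then k
     else if k \<le> N + b N then Suc N + (k - N) mod b N
     else if q then Suc N + b N + \<tau> N (k - (Suc N + b N))
     else k)"

definition tower_map :: "(nat \<Rightarrow> bool) \<Rightarrow> nat \<Rightarrow> bool" where
  "tower_map x =
    (if \<exists>i. \<not> x i then let N = LEAST i. \<not> x i in (\<lambda>k. x (source N (marked N x) k)) else x)"

lemma tower_map_eq: "first_zero x N \<Longrightarrow> tower_map x k = x (source N (marked N x) k)"
  using Least_first_zero[of x N] unfolding tower_map_def by (auto simp: first_zero_def)

lemma source_prefix: "k \<le> N \<Longrightarrow> source N q k = k"
  by (simp add: source_def)

lemma source_clock: "l < b N \<Longrightarrow> source N q (Suc N + l) = Suc N + Suc l mod b N"
  by (simp add: source_def Suc_diff_le)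

lemma source_tape: "source N q (Suc N + b N + j) = Suc N + b N + (if q then \<tau> N j else j)"
  by (simp add: source_def)

lemma source_le: "N < k \<Longrightarrow> source N q k \<le> k + Suc N"
proof -
  assume "N < k"
  then have "Suc N + (k - N) mod b N \<le> k + Suc N" using mod_less_eq_dividend[of "k - N" "b N"] by linarith
  moreover have "Suc N + b N + \<tau> N (k - (Suc N + b N)) \<le> k + Suc N" if "\<not> k \<le> N + b N"
    using that shift_until_failure_le[of "T N" "a N" "k - (Suc N + b N)"] a_le[of N] by linarith
  ultimately show ?thesis unfolding source_def by auto
qed

lemma position_cases:
  obtains "k \<le> N" | l where "l < b N" "k = Suc N + l" | j where "k = Suc N + b N + j"
  by (metis add_diff_inverse_nat not_less_eq le_less_linear less_diff_conv2 add.commute not_less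
      less_Suc_eq_le nat_add_left_cancel_less)

lemma tower_map_fixes_ones:
  assumes "\<forall>i<k. x i"
  shows "tower_map x k = x k"
proof (cases "\<exists>i. \<not> x i")
  case True
  then have z: "first_zero x (LEAST i. \<not> x i)" by (rule first_zero_Least)
  then have "k \<le> (LEAST i. \<not> x i)" using assms unfolding first_zero_def by (meson not_le)
  with tower_map_eq[OF z] show ?thesis by (simp add: source_prefix)
qed (simp add: tower_map_def)

lemma first_zero_tower_map: "first_zero x N \<Longrightarrow> first_zero (tower_map x) N"
  unfolding first_zero_def by (auto simp: tower_map_fixes_ones)

lemma funpow_fixes_ones: "\<forall>i<m. x i \<Longrightarrow> \<forall>i<m. (tower_map ^^ k) x i"
  by (induction k) (auto simp: tower_map_fixes_ones)

lemma first_zero_funpow: "first_zero x N \<Longrightarrow> first_zero ((tower_map ^^ k) x) N"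
  by (induction k) (auto simp: first_zero_tower_map)

lemma marked_cong:
  assumes "\<forall>i<Suc N + b N. x i = y i"
  shows "marked N x = marked N y"
  using assms unfolding marked_def by simp

text \<open>
  A symbol at a position in the clock or before does not depend on the state of the clock, and for a
  position behind it the whole clock is visible.
\<close>

lemma tower_map_local:
  assumes "\<forall>i<2 * n. x i = y i"
  shows "\<forall>i<n. tower_map x i = tower_map y i"
proof (intro allI impI)
  fix k assume "k < n"
  show "tower_map x k = tower_map y k"
  proof (cases rule: first_zero_cases[of k x])
    case 1
    moreover have "\<forall>i<k. y i" using 1 assms \<open>k < n\<close> by simp
    ultimately show ?thesis using assms \<open>k < n\<close> by (simp add: tower_map_fixes_ones)
  next
    case (2 N)
    have "first_zero y N" using 2 assms \<open>k < n\<close> by (simp add: first_zero_def)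
    moreover have "source N (marked N x) k = source N (marked N y) k"
    proof (cases "k \<le> N + b N")
      case True
      then show ?thesis by (simp add: source_def)
    next
      case False
      then have "marked N x = marked N y" using assms \<open>k < n\<close> by (intro marked_cong) simp
      then show ?thesis by simp
    qed
    moreover have "source N (marked N x) k < 2 * n"
      using source_le[OF \<open>N < k\<close>, of "marked N x"] \<open>N < k\<close> \<open>k < n\<close> by linarith
    ultimately show ?thesis using 2 assms by (simp add: tower_map_eq)
  qed
qed

lemma inj_source: "inj (source N q)"
proof (rule injI)
  fix i k assume eq: "source N q i = source N q k"
  have rot: "Suc l mod b N < b N" for l using b_pos by simp
  have rot': "b N + z \<noteq> Suc l mod b N" for l z using rot[of l] by linarith
  have inj_rot: "l = l'" if "l < b N" "l' < b N" "Suc l mod b N = Suc l' mod b N" for l l'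
    using that by (simp add: mod_Suc split: if_splits)
  have inj_\<tau>: "\<tau> N j = \<tau> N j' \<Longrightarrow> j = j'" for j j'
    using inj_shift_until_failure[OF a_pos] by (auto dest: injD)
  show "i = k"
  proof (cases rule: position_cases[of i N])
    case 1
    then show ?thesis using eq by (cases rule: position_cases[of k N])
        (auto simp: source_prefix source_clock source_tape simp del: add_Suc)
  next
    case (2 l)
    then show ?thesis using eq rot[of l] inj_rot[of l]
      by (cases rule: position_cases[of k N])
        (auto simp: source_prefix source_clock source_tape simp del: add_Suc)
  next
    case (3 j)
    then show ?thesis using eq inj_\<tau>
      by (cases rule: position_cases[of k N])
        (auto simp: rot' source_prefix source_clock source_tape simp del: add_Suc split: if_splits)
  qed
qed

text \<open>
  Composition with an injective position map is onto. The preimage must also have the state of the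
  clock for which its position map was chosen; that state can be read off the image, whose clock
  is the rotated one.
\<close>

lemma surj_tower_map: "surj tower_map"
proof -
  have "\<exists>x. tower_map x = y" for y
  proof (cases "\<exists>i. \<not> y i")
    case False
    then show ?thesis by (intro exI[of _ y]) (simp add: tower_map_def)
  next
    case True
    then obtain N where N: "first_zero y N" using first_zero_Least by blast
    \<comment> \<open>The clock \<open>1 0 \<dots> 0\<close> has the image \<open>0 \<dots> 0 1\<close>.\<close>
    define q where "q \<longleftrightarrow> (\<forall>l<b N. y (Suc N + l) \<longleftrightarrow> Suc l = b N)"
    define x where "x i = y (inv (source N q) i)" for i
    have x: "x (source N q k) = y k" for k
      unfolding x_def by (simp add: inv_f_f[OF inj_source])
    have "x k = y k" if "k \<le> N" for k using x[of k] that by (simp add: source_prefix)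
    then have zero: "first_zero x N" using N by (simp add: first_zero_def)
    have rot: "x (Suc N + Suc l mod b N) = y (Suc N + l)" if "l < b N" for l
      using x[of "Suc N + l"] that by (simp only: source_clock)
    have "marked N x \<longleftrightarrow> (\<forall>l<b N. x (Suc N + Suc l mod b N) \<longleftrightarrow> Suc l mod b N = 0)"
    proof -
      have "\<exists>l'<b N. l = Suc l' mod b N" if "l < b N" for l
      proof (cases l)
        case 0
        then show ?thesis using b_pos[of N] by (intro exI[of _ "b N - 1"]) simp
      next
        case (Suc l')
        then show ?thesis using that by (intro exI[of _ l']) simp
      qed
      moreover have "Suc l mod b N < b N" for l using b_pos by simp
      ultimately show ?thesis unfolding marked_def by metis
    qed
    also have "\<dots> \<longleftrightarrow> q"
      unfolding q_def using rot by (auto simp: mod_Suc)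
    finally have "tower_map x = y" using x by (auto simp: tower_map_eq[OF zero])
    then show ?thesis by blast
  qed
  then show ?thesis unfolding surj_def by metis
qed

definition tape_moves :: "nat \<Rightarrow> (nat \<Rightarrow> bool) \<Rightarrow> nat \<Rightarrow> nat" where
  "tape_moves N x t = card {s. s < t \<and> marked N ((tower_map ^^ s) x)}"

lemma tape_moves_0 [simp]: "tape_moves N x 0 = 0"
  by (simp add: tape_moves_def)

lemma tape_moves_Suc: "tape_moves N x (Suc t) = tape_moves N x t + of_bool (marked N ((tower_map ^^ t) x))"
proof -
  have "{s. s < Suc t \<and> marked N ((tower_map ^^ s) x)} =
      (if marked N ((tower_map ^^ t) x) then insert t else id) {s. s < t \<and> marked N ((tower_map ^^ s) x)}"
    by (auto simp: less_Suc_eq)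
  then show ?thesis by (simp add: tape_moves_def)
qed

context
  fixes x N
  assumes zero: "first_zero x N"
begin

lemma funpow_clock:
  "l < b N \<Longrightarrow> (tower_map ^^ t) x (Suc N + l) = x (Suc N + (l + t) mod b N)"
proof (induction t arbitrary: l)
  case (Suc t)
  have "(tower_map ^^ Suc t) x (Suc N + l) = (tower_map ^^ t) x (Suc N + Suc l mod b N)"
    using tower_map_eq[OF first_zero_funpow[OF zero]] Suc.prems by (simp only: funpow.simps o_apply source_clock)
  also have "\<dots> = x (Suc N + (Suc l mod b N + t) mod b N)"
    by (rule Suc.IH) (simp add: b_pos)
  finally show ?case by (simp add: mod_simps)
qed simp

lemma funpow_tape:
  "(tower_map ^^ t) x (Suc N + b N + j) = x (Suc N + b N + (\<tau> N ^^ tape_moves N x t) j)"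
proof (induction t arbitrary: j)
  case (Suc t)
  let ?q = "marked N ((tower_map ^^ t) x)"
  have "(tower_map ^^ Suc t) x (Suc N + b N + j) =
      (tower_map ^^ t) x (Suc N + b N + (if ?q then \<tau> N j else j))"
    using tower_map_eq[OF first_zero_funpow[OF zero]] by (simp only: funpow.simps o_apply source_tape)
  then show ?case by (simp only: Suc.IH) (simp add: tape_moves_Suc funpow_swap1)
qed simp

lemma marked_funpow:
  "marked N ((tower_map ^^ t) x) \<longleftrightarrow> (\<forall>l<b N. x (Suc N + l) \<longleftrightarrow> l = t mod b N)"
proof -
  have "marked N ((tower_map ^^ t) x) \<longleftrightarrow>
      (\<forall>l<b N. x (Suc N + (l + t) mod b N) \<longleftrightarrow> (l + t) mod b N = t mod b N)"
  proof -
    have "(l + t) mod b N = t mod b N \<longleftrightarrow> l = 0" if "l < b N" for l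
      using that mod_eq_dvd_iff_nat[of t "l + t" "b N"] by (auto dest: dvd_imp_le)
    then show ?thesis unfolding marked_def by (simp add: funpow_clock del: add_Suc)
  qed
  also have "\<dots> \<longleftrightarrow> (\<forall>l<b N. x (Suc N + l) \<longleftrightarrow> l = t mod b N)"
  proof -
    have "\<exists>l'<b N. l = (l' + t) mod b N" if "l < b N" for l
    proof (intro exI conjI)
      show "(l + (b N - t mod b N)) mod b N < b N" by (simp add: b_pos)
      have "t mod b N < b N" by (simp add: b_pos)
      have "((l + (b N - t mod b N)) mod b N + t) mod b N = (l + (b N - t mod b N) + t mod b N) mod b N"
        by (simp add: mod_simps)
      also have "l + (b N - t mod b N) + t mod b N = l + b N" using \<open>t mod b N < b N\<close> by simp
      also have "(l + b N) mod b N = l" using that by simp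
      finally show "l = ((l + (b N - t mod b N)) mod b N + t) mod b N" ..
    qed
    moreover have "(l + t) mod b N < b N" for l by (simp add: b_pos)
    ultimately show ?thesis by metis
  qed
  finally show ?thesis .
qed

text \<open>
  A clock with a single one, at position \<open>p\<close>, triggers exactly at the times congruent to \<open>p\<close>. For
  \<open>p = b N - 1\<close> the number of moves is just \<open>t div b N\<close>.
\<close>

lemma tape_moves_single:
  assumes "p < b N" "\<forall>l<b N. x (Suc N + l) \<longleftrightarrow> l = p"
  shows "tape_moves N x t = (t + (b N - Suc p)) div b N"
proof (induction t)
  case 0
  show ?case using assms(1) by simp
next
  case (Suc t)
  have "marked N ((tower_map ^^ t) x) \<longleftrightarrow> t mod b N = p"
    unfolding marked_funpow using assms b_pos[of N] by (metis mod_less_divisor)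
  moreover have "Suc (t + (b N - Suc p)) mod b N = 0 \<longleftrightarrow> t mod b N = p"
  proof -
    define s where "s = t mod b N"
    have s: "s < b N" by (simp add: s_def b_pos)
    have "Suc (t + (b N - Suc p)) = t + (b N - p)" using assms(1) by simp
    then have "Suc (t + (b N - Suc p)) mod b N = (s + (b N - p)) mod b N"
      by (simp only: s_def mod_add_left_eq)
    also have "\<dots> = 0 \<longleftrightarrow> s = p"
    proof (cases "s < p")
      case False
      then have "s + (b N - p) = (s - p) + b N" using assms(1) by simp
      then have "(s + (b N - p)) mod b N = s - p" using s by (simp only: mod_add_self2) simp
      with False show ?thesis by simp
    qed (use assms(1) in simp)
    finally show ?thesis by (simp add: s_def)
  qed
  ultimately show ?case by (simp add: tape_moves_Suc Suc div_Suc)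
qed

text \<open>
  A clock without exactly one one never triggers, so the rate of tape moves is at most \<open>1 / b N\<close>
  for all points.
\<close>

lemma tape_moves_le: "tape_moves N x t * b N \<le> t + b N"
proof (cases "\<exists>s. marked N ((tower_map ^^ s) x)")
  case True
  then obtain s where "\<forall>l<b N. x (Suc N + l) \<longleftrightarrow> l = s mod b N" using marked_funpow by blast
  then have "tape_moves N x t = (t + (b N - Suc (s mod b N))) div b N"
    by (intro tape_moves_single) (simp add: b_pos)
  then have "tape_moves N x t * b N \<le> t + (b N - Suc (s mod b N))" by (simp add: div_times_less_eq_dividend)
  then show ?thesis by simp
qed (simp add: tape_moves_def)

lemma tape_moves_cong:
  assumes "\<forall>i<Suc N + b N. x i = y i" "first_zero y N"
  shows "tape_moves N x t = card {s. s < t \<and> (\<forall>l<b N. y (Suc N + l) \<longleftrightarrow> l = s mod b N)}"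
  using assms unfolding tape_moves_def marked_funpow by simp

end

text \<open>
  In a period of the clock the tape moves once, by \<open>a N\<close> cells, or it is confined to a bounded part.
  Either way the cells visible up to time \<open>t\<close> lie below a constant plus \<open>h t\<close>.
\<close>

lemma orbit_bound:
  assumes h: "(\<forall>s. T N s) \<Longrightarrow> real (a N) / real (b N) \<le> h" and "h \<ge> 0"
  shows "\<exists>C. \<forall>r j t. j < m \<longrightarrow> r * b N \<le> t + b N \<longrightarrow> real ((\<tau> N ^^ r) j) \<le> real C + h * real t"
proof (cases "\<forall>s. T N s")
  case False
  then obtain C where C: "\<forall>r j. j < m \<longrightarrow> (\<tau> N ^^ r) j \<le> C"
    using shift_until_failure_bounded by blast
  have "real ((\<tau> N ^^ r) j) \<le> real C + h * real t" if "j < m" for r j t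
  proof -
    have "real ((\<tau> N ^^ r) j) \<le> real C" using C that by simp
    moreover have "0 \<le> h * real t" using \<open>h \<ge> 0\<close> by simp
    ultimately show ?thesis by linarith
  qed
  then show ?thesis by blast
next
  case True
  have "real ((\<tau> N ^^ r) j) \<le> real (m + a N) + h * real t" if "j < m" "r * b N \<le> t + b N" for r j t
  proof -
    have b: "0 < real (b N)" by (simp add: b_pos)
    have "real r * real (b N) \<le> real t + real (b N)" using that(2) by (metis of_nat_add of_nat_le_iff of_nat_mult)
    then have "real r \<le> (real t + real (b N)) / real (b N)" using b by (simp add: pos_le_divide_eq)
    then have "real (a N) * real r \<le> real (a N) * ((real t + real (b N)) / real (b N))"
      by (rule mult_left_mono) simp
    also have "\<dots> = real (a N) / real (b N) * real t + real (a N)" using b by (simp add: field_simps)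
    also have "\<dots> \<le> h * real t + real (a N)" using mult_right_mono[OF h[OF True], of "real t"] by simp
    finally have "real (a N * r) \<le> h * real t + real (a N)" by simp
    moreover have "(\<tau> N ^^ r) j = j + a N * r" using True by (intro shift_until_failure_never) simp
    ultimately show ?thesis using that(1) by simp
  qed
  then show ?thesis by blast
qed

text \<open>
  Only the systems \<open>N < m\<close> can be told apart by \<open>m\<close> symbols, hence finitely many constants from
  \<open>orbit_bound\<close> combine to one. Points outside these systems start with \<open>m\<close> ones forever.
\<close>

lemma topological_entropy_tower_map_le:
  assumes "h \<ge> 0" and h: "\<And>N. (\<forall>s. T N s) \<Longrightarrow> real (a N) / real (b N) \<le> h"
  shows "topological_entropy tower_map \<le> ereal h"
proof (rule topological_entropy_le[OF \<open>h \<ge> 0\<close>])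
  fix m
  obtain C where C: "\<And>N r j t. j < m \<Longrightarrow> r * b N \<le> t + b N \<Longrightarrow>
      real ((\<tau> N ^^ r) j) \<le> real (C N) + h * real t"
    using orbit_bound[OF h \<open>h \<ge> 0\<close>, of _ m] by metis
  define D where "D = m + (\<Sum>N<m. Suc (Suc N + b N + C N))"
  have D: "m \<le> D" "\<And>N. N < m \<Longrightarrow> Suc N + b N + C N < D"
  proof -
    show "m \<le> D" by (simp add: D_def)
    fix N assume "N < m"
    then have "Suc (Suc N + b N + C N) \<le> (\<Sum>N<m. Suc (Suc N + b N + C N))"
      by (intro member_le_sum) auto
    then show "Suc N + b N + C N < D" by (simp add: D_def)
  qed
  have "itinerary tower_map m n x = itinerary tower_map m n y"
    if xy: "\<And>i. real i < real D + h * real n \<Longrightarrow> x i = y i" for n x y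
    unfolding itinerary_eq_iff
  proof (intro allI impI)
    fix t i assume "t < n" "i < m"
    have "0 \<le> h * real n" using \<open>h \<ge> 0\<close> by simp
    then have agree: "x i = y i" if "i < D" for i using that by (intro xy) linarith
    show "(tower_map ^^ t) x i = (tower_map ^^ t) y i"
    proof (cases rule: first_zero_cases[of m x])
      case 1
      moreover have "\<forall>i<m. y i" using 1 agree D(1) by simp
      ultimately show ?thesis using \<open>i < m\<close> by (simp add: funpow_fixes_ones)
    next
      case (2 N)
      note zx = \<open>first_zero x N\<close>
      have head: "\<forall>i<Suc N + b N. x i = y i" using agree D(2)[OF \<open>N < m\<close>] by simp
      have zy: "first_zero y N" using zx head by (simp add: first_zero_def)
      have same: "tape_moves N x t = tape_moves N y t"
        using tape_moves_cong[OF zx head zy] tape_moves_cong[OF zy _ zy] by simp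
      show ?thesis
      proof (cases rule: position_cases[of i N])
        case 1
        then show ?thesis using first_zero_funpow[OF zx, of t] first_zero_funpow[OF zy, of t]
          unfolding first_zero_def by (metis le_neq_implies_less)
      next
        case (2 l)
        have "(l + t) mod b N < b N" by (simp add: b_pos)
        then show ?thesis using 2 head by (simp add: funpow_clock[OF zx] funpow_clock[OF zy] del: add_Suc)
      next
        case (3 j)
        let ?k = "(\<tau> N ^^ tape_moves N x t) j"
        have "real ?k \<le> real (C N) + h * real t"
          using 3 \<open>i < m\<close> by (intro C tape_moves_le zx) simp
        also have "h * real t \<le> h * real n" using \<open>h \<ge> 0\<close> \<open>t < n\<close> by (intro mult_left_mono) auto
        finally have "real (Suc N + b N + ?k) < real D + h * real n"
          using D(2)[OF \<open>N < m\<close>] by linarith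
        from xy[OF this] show ?thesis
          unfolding 3 funpow_tape[OF zx] funpow_tape[OF zy] same .
      qed
    qed
  qed
  then show "\<exists>D. \<forall>n x y. (\<forall>i. real i < real D + h * real n \<longrightarrow> x i = y i) \<longrightarrow>
      itinerary tower_map m n x = itinerary tower_map m n y"
    by blast
qed

text \<open>
  With the clock set to \<open>0 \<dots> 0 1\<close>, the window of \<open>a N\<close> tape cells shows block \<open>r\<close> at time \<open>r * b N\<close>.
  Within \<open>n\<close> steps \<open>K \<ge> n / b N\<close> blocks can be read, so their contents \<open>S\<close> are all distinguished.
\<close>

lemma topological_entropy_tower_map_ge:
  assumes good: "\<forall>s. T N s"
  shows "ereal (real (a N) / real (b N)) \<le> topological_entropy tower_map"
proof (rule topological_entropy_ge)
  fix n :: nat assume "1 \<le> n"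
  define K where "K = Suc ((n - 1) div b N)"
  define m where "m = Suc N + b N + a N"
  \<comment> \<open>The point \<open>1\<^sup>N 0 0 \<dots> 0 1 y\<close> with \<open>S\<close> the set of positions of ones in \<open>y\<close>.\<close>
  define x where "x S i \<longleftrightarrow> i < N \<or> i = N + b N \<or> N + b N < i \<and> i - (Suc N + b N) \<in> S" for S i
  let ?I = "\<lambda>S. itinerary tower_map m n (x S)"
  have zero: "first_zero (x S) N" for S
    using b_pos[of N] by (simp add: first_zero_def x_def)
  have "tape_moves N (x S) t = t div b N" for S t
  proof -
    have "\<forall>l<b N. x S (Suc N + l) \<longleftrightarrow> l = b N - 1" using b_pos[of N] by (auto simp: x_def)
    from tape_moves_single[OF zero _ this] show ?thesis using b_pos[of N] by simp
  qed
  then have tape: "(tower_map ^^ t) (x S) (Suc N + b N + j) \<longleftrightarrow> j + a N * (t div b N) \<in> S" for S t j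
    using good by (simp add: funpow_tape[OF zero] shift_until_failure_never del: add_Suc) (simp add: x_def)
  have "inj_on ?I (Pow {..<a N * K})"
  proof (rule inj_onI)
    have *: "p \<in> S \<longleftrightarrow> p \<in> S'" if "?I S = ?I S'" "p < a N * K" for S S' p
    proof -
      have "p div a N < K" using that(2) by (simp add: less_mult_imp_div_less mult.commute)
      then have "p div a N * b N \<le> (n - 1) div b N * b N" by (simp add: K_def less_Suc_eq_le)
      also have "\<dots> \<le> n - 1" by (rule div_times_less_eq_dividend)
      finally have "p div a N * b N < n" using \<open>1 \<le> n\<close> by simp
      moreover have "Suc N + b N + p mod a N < m" using a_pos[of N] by (simp add: m_def)
      ultimately have "(tower_map ^^ (p div a N * b N)) (x S) (Suc N + b N + p mod a N) =
          (tower_map ^^ (p div a N * b N)) (x S') (Suc N + b N + p mod a N)"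
        using that(1) unfolding itinerary_eq_iff by blast
      then show ?thesis unfolding tape using b_pos[of N] by simp
    qed
    fix S S' assume "S \<in> Pow {..<a N * K}" "S' \<in> Pow {..<a N * K}" "?I S = ?I S'"
    then show "S = S'" using * by blast
  qed
  then have "card (?I ` Pow {..<a N * K}) = 2 ^ (a N * K)"
    by (simp add: card_image card_Pow)
  moreover have "card (?I ` Pow {..<a N * K}) \<le> card (range (itinerary tower_map m n))"
    by (intro card_mono finite_range_itinerary) auto
  ultimately have "2 ^ (a N * K) \<le> real (card (range (itinerary tower_map m n)))"
    by (metis of_nat_le_iff of_nat_numeral of_nat_power)
  then have "log 2 (2 ^ (a N * K)) \<le> log 2 (real (card (range (itinerary tower_map m n))))"
    by (intro log_mono) auto
  then have "real (a N) * real K \<le> log 2 (real (card (range (itinerary tower_map m n))))" by simp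
  moreover have "real n \<le> real (b N) * real K"
  proof -
    have "n - 1 < b N + (n - 1) div b N * b N" using dividend_less_times_div[of "b N" "n - 1"] b_pos[of N]
      by (simp add: mult.commute)
    then have "n \<le> b N * K" by (simp add: K_def algebra_simps)
    then show ?thesis by (metis of_nat_le_iff of_nat_mult)
  qed
  then have "real (a N) / real (b N) * real n \<le> real (a N) / real (b N) * (real (b N) * real K)"
    by (rule mult_left_mono) simp
  ultimately show "real (a N) / real (b N) * real n \<le> log 2 (real (card (range (itinerary tower_map m n))))"
    using b_pos[of N] by simp
qed

end

section \<open>Realization of given entropies\<close>

lemma (in tower_family) computable_tower_map:
  assumes a: "recursive 1 (\<lambda>e. a (e 0))" and b: "recursive 1 (\<lambda>e. b (e 0))"
    and T: "decidable 2 (\<lambda>e. T (e 0) (e 1))"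
  shows "computable_map tower_map"
proof -
  note intros = recursive_intros recursive_compose1[OF a] recursive_compose1[OF b]
    decidable_compose2[OF T] recursive_var
  have zero: "\<exists>i. \<not> bit c i" for c :: nat
    using bit_prefix_code[of c "bit c" c] by (intro exI[of _ c]) (simp add: prefix_code_bit)
  have Z: "recursive 1 (\<lambda>e. LEAST i. \<not> bit (e 0) i)"
    by (intro recursive_Least intros zero) simp_all
  have \<tau>: "recursive 2 (\<lambda>e. \<tau> (e 0) (e 1))"
    unfolding shift_until_failure_def by (intro intros) simp_all
  have M: "decidable 2 (\<lambda>e. marked (e 0) (bit (e 1)))"
    unfolding marked_def by (intro intros) simp_all
  have "recursive 2 (\<lambda>e. source (LEAST i. \<not> bit (e 0) i)
      (marked (LEAST i. \<not> bit (e 0) i) (bit (e 0))) (e 1))"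
    unfolding source_def
    by (intro intros recursive_compose1[OF Z] recursive_compose2[OF \<tau>] decidable_compose2[OF M]) simp_all
  note src = recursive_compose2[OF this]
  have "tower_map (bit c) k \<longleftrightarrow> bit c (source (LEAST i. \<not> bit c i)
      (marked (LEAST i. \<not> bit c i) (bit c)) k)" for c k :: nat
    using zero[of c] by (simp add: tower_map_def Let_def)
  then have "recursive 2 (\<lambda>e. prefix_code (e 0) (tower_map (bit (e 1))))"
    by (intro recursive_prefix_code) (simp_all only:, (intro intros src; simp)+)
  then obtain p where p: "\<And>e. eval p (map e [0..<2]) (prefix_code (e 0) (tower_map (bit (e 1))))"
    unfolding recursive_def by blast
  have "eval p [n, prefix_code (2 * n) x] (prefix_code n (tower_map x))" for n x
  proof -
    have "prefix_code n (tower_map (bit (prefix_code (2 * n) x))) = prefix_code n (tower_map x)"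
      unfolding prefix_code_eq_iff by (rule tower_map_local) (simp add: bit_prefix_code)
    then show ?thesis
      using p[of "\<lambda>i. if i = 0 then n else prefix_code (2 * n) x"] by (simp add: upt_rec)
  qed
  moreover have "computable 1 (\<lambda>xs. 2 * xs ! 0)"
    unfolding recursive_iff_computable1[symmetric] by (intro intros) simp
  ultimately show ?thesis
    unfolding computable_map_def by (intro exI[of _ "\<lambda>n. 2 * n"]) (auto simp: mono_def)
qed

text \<open>
  The number \<open>N\<close> codes the index \<open>i\<close> and the fraction \<open>a / b\<close>, both parts of which are made positive by
  \<open>Suc\<close>. This loses nothing: the value \<open>0\<close> is provided by the nonnegativity of entropy.
\<close>

theorem Sigma2_computable_realized:
  assumes "Sigma2_computable h" "h \<ge> 0"
  shows "\<exists>f. computable_map f \<and> surj f \<and> topological_entropy f = ereal h"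
proof -
  obtain q where "computable_rat_seq2 q" and h: "ereal h = (SUP i. INF j. ereal (of_rat (q i j)))"
    using assms(1) unfolding Sigma2_computable_def by blast
  then obtain A B C where A: "recursive 2 (\<lambda>e. A (e 0) (e 1))"
    and B: "recursive 2 (\<lambda>e. B (e 0) (e 1))" and C: "recursive 2 (\<lambda>e. C (e 0) (e 1))"
    and q: "\<And>i j. q i j = (of_nat (A i j) - of_nat (B i j)) / of_nat (Suc (C i j))"
    unfolding computable_rat_seq2_def recursive_iff_computable2 by blast
  define idx where "idx N = fst (prod_decode N)" for N
  define a where "a N = Suc (fst (prod_decode (snd (prod_decode N))))" for N
  define b where "b N = Suc (snd (prod_decode (snd (prod_decode N))))" for N
  define T where "T N j \<longleftrightarrow> a N * Suc (C (idx N) j) + B (idx N) j * b N \<le> A (idx N) j * b N" for N j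
  have fst_le: "fst (prod_decode n) \<le> n" and snd_le: "snd (prod_decode n) \<le> n" for n
    using le_prod_encode_1[of "fst (prod_decode n)" "snd (prod_decode n)"]
      le_prod_encode_2[of "snd (prod_decode n)" "fst (prod_decode n)"] by simp_all
  interpret tower_family a b T
  proof
    show "a N \<le> Suc N" for N
      unfolding a_def using le_trans[OF fst_le snd_le] by simp
  qed (simp_all add: a_def b_def)
  have T_iff: "T N j \<longleftrightarrow> real (a N) / real (b N) \<le> of_rat (q (idx N) j)" for N j
  proof -
    define c where "c = real (Suc (C (idx N) j))"
    have pos: "0 < real (b N)" "0 < c" by (simp_all add: b_def c_def)
    have "T N j \<longleftrightarrow> real (a N) * c + real (B (idx N) j) * real (b N) \<le> real (A (idx N) j) * real (b N)"
      unfolding T_def c_def by (simp only: of_nat_add of_nat_mult of_nat_le_iff flip: of_nat_add of_nat_mult)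
    also have "\<dots> \<longleftrightarrow> real (a N) / real (b N) \<le> (real (A (idx N) j) - real (B (idx N) j)) / c"
      using pos by (simp add: field_simps)
    also have "(real (A (idx N) j) - real (B (idx N) j)) / c = of_rat (q (idx N) j)"
      by (simp add: q c_def of_rat_divide of_rat_diff del: of_nat_Suc)
    finally show ?thesis .
  qed
  have "recursive 1 (\<lambda>e. a (e 0))" "recursive 1 (\<lambda>e. b (e 0))"
    unfolding a_def b_def by (intro recursive_intros recursive_var; simp)+
  moreover have "decidable 2 (\<lambda>e. T (e 0) (e 1))"
    unfolding T_def a_def b_def idx_def
    by (intro recursive_intros recursive_var recursive_compose2[OF A] recursive_compose2[OF B]
        recursive_compose2[OF C]) simp_all
  ultimately have "computable_map tower_map" by (rule computable_tower_map)
  moreover have "topological_entropy tower_map = ereal h"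
  proof (rule antisym)
    show "topological_entropy tower_map \<le> ereal h"
    proof (rule topological_entropy_tower_map_le[OF assms(2)])
      fix N assume "\<forall>s. T N s"
      then have "ereal (real (a N) / real (b N)) \<le> (INF j. ereal (of_rat (q (idx N) j)))"
        by (intro INF_greatest) (simp add: T_iff)
      also have "\<dots> \<le> ereal h" unfolding h by (rule SUP_upper) simp
      finally show "real (a N) / real (b N) \<le> h" by simp
    qed
    show "ereal h \<le> topological_entropy tower_map"
    proof (rule dense_le)
      fix z assume "z < ereal h"
      show "z \<le> topological_entropy tower_map"
      proof (cases "z < 0")
        case True
        then show ?thesis using topological_entropy_nonneg[of tower_map] by simp
      next
        case False
        obtain i where i: "z < (INF j. ereal (of_rat (q i j)))"
          using \<open>z < ereal h\<close> unfolding h less_SUP_iff by blast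
        obtain z' where z': "z < ereal z'" "ereal z' < (INF j. ereal (of_rat (q i j)))"
          using ereal_dense2[OF i] by blast
        obtain r where z: "z = ereal r" "0 \<le> r"
          using False z'(1) by (cases z) auto
        with z'(1) have "r < z'" by simp
        then obtain w where w: "w \<in> \<rat>" "r < w" "w < z'" using Rats_dense_in_real by blast
        with z(2) have "0 < w" by simp
        with w(1) obtain m n :: nat where mn: "n \<noteq> 0" "\<bar>w\<bar> = real m / real n"
          by (elim Rats_abs_nat_div_natE)
        with \<open>0 < w\<close> have w_eq: "w = real m / real n" by simp
        with \<open>0 < w\<close> have "m \<noteq> 0" by (cases m) auto
        define N where "N = prod_encode (i, prod_encode (m - 1, n - 1))"
        have N: "idx N = i" "a N = m" "b N = n"
          using mn(1) \<open>m \<noteq> 0\<close> by (simp_all add: N_def idx_def a_def b_def)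
        have "T N j" for j
        proof -
          have "ereal w < ereal z'" using w(3) by simp
          also have "\<dots> < (INF j. ereal (of_rat (q i j)))" by (rule z')
          also have "\<dots> \<le> ereal (of_rat (q i j))" by (rule INF_lower) simp
          finally show ?thesis unfolding T_iff N w_eq[symmetric] by simp
        qed
        then have "ereal (real (a N) / real (b N)) \<le> topological_entropy tower_map"
          by (intro topological_entropy_tower_map_ge) simp
        then have "ereal w \<le> topological_entropy tower_map" by (simp add: N w_eq)
        moreover have "z \<le> ereal w" using z w(2) by simp
        ultimately show ?thesis by (rule order_trans[rotated])
      qed
    qed
  qed
  ultimately show ?thesis using surj_tower_map by blast
qed

theorem theorem29:
  fixes h :: real
  assumes "h \<ge> 0"
  shows "(\<exists>f :: (nat \<Rightarrow> bool) \<Rightarrow> nat \<Rightarrow> bool.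
            computable_map f \<and> surj f \<and> topological_entropy f = ereal h)
          \<longleftrightarrow> Sigma2_computable h"
  using assms Sigma2_computable_topological_entropy Sigma2_computable_realized by blast

end
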